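(* Let $G=(V,E)$ be a finite undirected graph with at least one edge and maximum degree $d$, and let $F(\beta)$ denote the free energy of the Edwards-Anderson model on $G$. Then for any $\beta\in(0,\infty]$, $$\operatorname{Var}F(\beta)\ge\frac{9|E|}{32}\min\Bigl\{\beta^2,\frac1{4d^2}\Bigr\}.$$
   Context: The Edwards-Anderson Hamiltonian on $G$ is $H(\sigma)=-\sum_{(i,j)\in E}g_{ij}\sigma_i\sigma_j$, $\sigma\in\{-1,1\}^V$, where $(g_{ij})_{(i,j)\in E}$ are i.i.d. standard Gaussian random variables, one per edge. For $0<\beta<\infty$ the free energy is $F(\beta):=\frac1\beta\log\sum_{\sigma\in\{-1,1\}^V}e^{-\beta H(\sigma)}$; for $\beta=\infty$, $F(\infty):=\max_\sigma(-H(\sigma))$, which up to sign is the energy of the ground state. *)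

theory Defs
  imports "HOL-Probability.Probability"
begin

definition simple_graph :: "'v set \<Rightarrow> 'v set set \<Rightarrow> bool" where
  "simple_graph V E \<longleftrightarrow> finite V \<and> (\<forall>e\<in>E. e \<subseteq> V \<and> card e = 2)"

definition degree :: "'v set set \<Rightarrow> 'v \<Rightarrow> nat" where
  "degree E v = card {e \<in> E. v \<in> e}"

(* Max of the empty set is unspecified; a graph with an edge has a vertex. *)
definition max_degree :: "'v set \<Rightarrow> 'v set set \<Rightarrow> nat" where
  "max_degree V E = Max (degree E ` V)"

definition spin_configs :: "'v set \<Rightarrow> ('v \<Rightarrow> real) set" where
  "spin_configs V = V \<rightarrow>\<^sub>E {-1, 1}"

(* An edge is a two-element set {i, j}, so the product over its elements is
   \<sigma> i * \<sigma> j, and each undirected edge carries one coupling g e. *)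
definition hamiltonian :: "'v set set \<Rightarrow> ('v set \<Rightarrow> real) \<Rightarrow> ('v \<Rightarrow> real) \<Rightarrow> real" where
  "hamiltonian E g \<sigma> = - (\<Sum>e\<in>E. g e * (\<Prod>i\<in>e. \<sigma> i))"

(* Intended for 0 < \<beta> \<le> \<infinity>. *)
definition free_energy :: "'v set \<Rightarrow> 'v set set \<Rightarrow> ('v set \<Rightarrow> real) \<Rightarrow> ereal \<Rightarrow> real" where
  "free_energy V E g \<beta> =
     (if \<beta> = \<infinity>
      then Max ((\<lambda>\<sigma>. - hamiltonian E g \<sigma>) ` spin_configs V)
      else 1 / real_of_ereal \<beta> *
           ln (\<Sum>\<sigma>\<in>spin_configs V. exp (- real_of_ereal \<beta> * hamiltonian E g \<sigma>)))"

definition iid_std_gaussian :: "'w measure \<Rightarrow> 'i set \<Rightarrow> ('i \<Rightarrow> 'w \<Rightarrow> real) \<Rightarrow> bool" where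
  "iid_std_gaussian M I g \<longleftrightarrow>
     prob_space.indep_vars M (\<lambda>_. borel) g I \<and>
     (\<forall>i\<in>I. distributed M lborel (g i) std_normal_density)"

end

theory Submission
  imports Defs "HOL-Real_Asymp.Real_Asymp"
begin

text \<open>
  Test the free energy \<open>F\<close> against \<open>T = \<Sum>e\<in>E. ((g e)\<^sup>2 - 1)\<close>, for which \<open>E T = 0\<close> and
  \<open>E T\<^sup>2 = 2 |E|\<close>; by Cauchy--Schwarz it suffices to show \<open>E (F T) \<ge> 3/4 c |E|\<close> with
  \<open>c = min \<beta> (1 / (2 d))\<close>. Gaussian integration by parts turns \<open>E (F T)\<close> into the sum over the
  edges of \<open>E (g e m e)\<close>, where \<open>m e\<close> is the Gibbs average of the spin product along \<open>e\<close>.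
  Collect the edges at a vertex of degree \<open>k\<close>: if \<open>Y\<close> is the local field there, symmetry under
  the spin flip and Chebyshev's inequality bound their sum below by the average of \<open>Y tanh (c Y)\<close>
  over the Gibbs measure without these edges, which is independent of their couplings. So \<open>Y\<close>
  is Gaussian of variance \<open>k\<close>, and \<open>tanh u \<ge> u - u\<^sup>3 / 3\<close> gives the bound
  \<open>c k (1 - c\<^sup>2 k) \<ge> 3/4 c k\<close>. Summing over the vertices counts each edge twice. For
  \<open>\<beta> = \<infinity>\<close> let \<open>\<beta>\<close> tend to infinity in the covariance bound.
\<close>

subsection \<open>Hyperbolic functions\<close>

lemma tanh_le_self: "tanh u \<le> u" if "0 \<le> u" for u :: real
proof -
  have "(\<lambda>x. x - tanh x) 0 \<le> (\<lambda>x. x - tanh x) u"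
    by (rule DERIV_nonneg_imp_nondecreasing[OF that])
      (auto intro!: exI derivative_eq_intros)
  then show ?thesis by simp
qed

text \<open>The difference of the two sides vanishes at 0 and has derivative x^2 - (tanh x)^2, which
  is nonnegative by \<open>tanh_le_self\<close>.\<close>

lemma tanh_ge_cubic: "u - u ^ 3 / 3 \<le> tanh u" if "0 \<le> u" for u :: real
proof -
  have "(\<lambda>x. tanh x - (x - x ^ 3 / 3)) 0 \<le> (\<lambda>x. tanh x - (x - x ^ 3 / 3)) u"
  proof (rule DERIV_nonneg_imp_nondecreasing[OF that])
    fix x :: real assume "0 \<le> x" "x \<le> u"
    have "(tanh x)\<^sup>2 \<le> x\<^sup>2"
      using tanh_le_self[OF \<open>0 \<le> x\<close>] \<open>0 \<le> x\<close> by (intro power_mono) auto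
    moreover have "((\<lambda>x. tanh x - (x - x ^ 3 / 3)) has_real_derivative x\<^sup>2 - (tanh x)\<^sup>2) (at x)"
      by (auto intro!: derivative_eq_intros simp: field_simps)
    ultimately show "\<exists>y. ((\<lambda>x. tanh x - (x - x ^ 3 / 3)) has_real_derivative y) (at x) \<and> 0 \<le> y"
      by (intro exI[of _ "x\<^sup>2 - (tanh x)\<^sup>2"]) auto
  qed
  then show ?thesis by simp
qed

lemma times_tanh_abs: "y * tanh (b * y) = \<bar>y\<bar> * tanh (b * \<bar>y\<bar>)" for b y :: real
  by (cases "0 \<le> y") auto

text \<open>Both sides are even in \<open>y\<close>, so the cubic bound at \<bar>y\<bar> suffices.
  The minorant is a polynomial in the local field, so its Gaussian mean is explicit.\<close>

lemma times_tanh_ge: "b * y\<^sup>2 - b ^ 3 * y ^ 4 / 3 \<le> y * tanh (b * y)" if "0 \<le> b" for b y :: real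
proof -
  have "\<bar>y\<bar> * (b * \<bar>y\<bar> - (b * \<bar>y\<bar>) ^ 3 / 3) \<le> \<bar>y\<bar> * tanh (b * \<bar>y\<bar>)"
    using that by (intro mult_left_mono tanh_ge_cubic) auto
  also have "\<bar>y\<bar> * (b * \<bar>y\<bar> - (b * \<bar>y\<bar>) ^ 3 / 3) = b * \<bar>y\<bar>\<^sup>2 - b ^ 3 * \<bar>y\<bar> ^ 4 / 3"
    by (simp add: field_simps power_mult_distrib eval_nat_numeral)
  finally show ?thesis
    by (simp flip: times_tanh_abs)
qed

lemma times_sinh_eq: "y * sinh z = y * tanh z * cosh z" for y z :: real
  using cosh_real_pos[of z] by (simp add: tanh_def field_simps)

section \<open>Comonotone functions and Chebyshev's sum inequality\<close>

lemma times_tanh_cosh_comonotone: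
  fixes b c x y :: real
  assumes "0 \<le> b" "0 \<le> c"
  shows "0 \<le> (x * tanh (b * x) - y * tanh (b * y)) * (cosh (c * x) - cosh (c * y))"
proof -
  \<comment> \<open>On nonnegative arguments both functions are nondecreasing, so the two
    differences have the same sign. As both functions are even, the general case reduces to absolute
    values.\<close>
  have *: "0 \<le> (s * tanh (b * s) - t * tanh (b * t)) * (cosh (c * s) - cosh (c * t))"
    if "0 \<le> t" "t \<le> s" for s t :: real
  proof (rule mult_nonneg_nonneg)
    have "t * tanh (b * t) \<le> s * tanh (b * s)"
      using that assms by (intro mult_mono) (auto intro: mult_left_mono)
    then show "0 \<le> s * tanh (b * s) - t * tanh (b * t)" by simp
    have "cosh (c * t) \<le> cosh (c * s)"
      using that assms by (subst cosh_real_nonneg_le_iff) (auto intro: mult_left_mono)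
    then show "0 \<le> cosh (c * s) - cosh (c * t)" by simp
  qed
  have "cosh (c * x) = cosh (c * \<bar>x\<bar>)" for x
    by (metis assms(2) abs_mult abs_of_nonneg cosh_real_abs)
  then have eq: "(x * tanh (b * x) - y * tanh (b * y)) * (cosh (c * x) - cosh (c * y)) =
    (\<bar>x\<bar> * tanh (b * \<bar>x\<bar>) - \<bar>y\<bar> * tanh (b * \<bar>y\<bar>)) * (cosh (c * \<bar>x\<bar>) - cosh (c * \<bar>y\<bar>))"
    using times_tanh_abs by metis
  show ?thesis
  proof (cases "\<bar>y\<bar> \<le> \<bar>x\<bar>")
    case True
    then show ?thesis unfolding eq by (intro *) auto
  next
    case False
    then have "0 \<le> (\<bar>y\<bar> * tanh (b * \<bar>y\<bar>) - \<bar>x\<bar> * tanh (b * \<bar>x\<bar>)) * (cosh (c * \<bar>y\<bar>) - cosh (c * \<bar>x\<bar>))"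
      by (intro *) auto
    then show ?thesis unfolding eq by (simp add: algebra_simps)
  qed
qed

text \<open>Symmetrisation: the double sum of w x * w y * (f x - f y) * (h x - h y) is nonnegative,
  and after expansion its four terms agree in pairs under exchange of \<open>x\<close> and
  \<open>y\<close>.\<close>

lemma weighted_Chebyshev_sum:
  fixes w f h :: "'a \<Rightarrow> real"
  assumes "\<And>x. x \<in> A \<Longrightarrow> 0 \<le> w x"
    and "\<And>x y. x \<in> A \<Longrightarrow> y \<in> A \<Longrightarrow> 0 \<le> (f x - f y) * (h x - h y)"
  shows "(\<Sum>x\<in>A. w x * f x) * (\<Sum>x\<in>A. w x * h x) \<le> (\<Sum>x\<in>A. w x * f x * h x) * (\<Sum>x\<in>A. w x)"
proof -
  have "0 \<le> (\<Sum>x\<in>A. \<Sum>y\<in>A. w x * w y * ((f x - f y) * (h x - h y)))"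
    using assms by (intro sum_nonneg mult_nonneg_nonneg[of "w _ * w _"]) auto
  also have "\<dots> = (\<Sum>x\<in>A. \<Sum>y\<in>A. w x * f x * h x * w y) - (\<Sum>x\<in>A. \<Sum>y\<in>A. w x * f x * (w y * h y))
     - (\<Sum>x\<in>A. \<Sum>y\<in>A. w y * f y * (w x * h x)) + (\<Sum>x\<in>A. \<Sum>y\<in>A. w y * f y * h y * w x)"
    by (simp add: algebra_simps sum.distrib sum_subtractf)
  also have "(\<Sum>x\<in>A. \<Sum>y\<in>A. w y * f y * (w x * h x)) = (\<Sum>x\<in>A. \<Sum>y\<in>A. w x * f x * (w y * h y))"
    by (rule sum.swap)
  also have "(\<Sum>x\<in>A. \<Sum>y\<in>A. w y * f y * h y * w x) = (\<Sum>x\<in>A. \<Sum>y\<in>A. w x * f x * h x * w y)"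
    by (rule sum.swap)
  finally show ?thesis
    by (simp add: sum_product)
qed

subsection \<open>Gaussian integration by parts\<close>

text \<open>The binomial expansion of (1 + \<bar>x\<bar>)^3 reduces this to absolute moments up to
  order 3. Cubic growth is what a quadratic factor times a function of linear growth
  requires.\<close>

lemma integrable_std_normal_abs_bound:
  fixes f :: "real \<Rightarrow> real"
  assumes [measurable]: "f \<in> borel_measurable borel" and "\<And>x. \<bar>f x\<bar> \<le> C * (1 + \<bar>x\<bar>) ^ 3"
  shows "integrable lborel (\<lambda>x. std_normal_density x * f x)"
proof -
  have "integrable lborel (\<lambda>x. C * (std_normal_density x * \<bar>x\<bar> ^ 0 + 3 * (std_normal_density x * \<bar>x\<bar> ^ 1)
     + 3 * (std_normal_density x * \<bar>x\<bar> ^ 2) + std_normal_density x * \<bar>x\<bar> ^ 3))"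
    by (intro integrable_mult_right Bochner_Integration.integrable_add integrable_std_normal_moment_abs)
  then show ?thesis
  proof (rule Bochner_Integration.integrable_bound)
    show "AE x in lborel. norm (std_normal_density x * f x) \<le> norm (C * (std_normal_density x * \<bar>x\<bar> ^ 0 + 3 * (std_normal_density x * \<bar>x\<bar> ^ 1)
     + 3 * (std_normal_density x * \<bar>x\<bar> ^ 2) + std_normal_density x * \<bar>x\<bar> ^ 3))"
    proof (rule AE_I2)
      fix x :: real
      have "norm (std_normal_density x * f x) \<le> std_normal_density x * (C * (1 + \<bar>x\<bar>) ^ 3)"
        using assms(2)[of x] by (auto simp: abs_mult intro!: mult_left_mono)
      also have "\<dots> = C * (std_normal_density x * \<bar>x\<bar> ^ 0 + 3 * (std_normal_density x * \<bar>x\<bar> ^ 1)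
     + 3 * (std_normal_density x * \<bar>x\<bar> ^ 2) + std_normal_density x * \<bar>x\<bar> ^ 3)"
        by (simp add: algebra_simps eval_nat_numeral)
      finally show "norm (std_normal_density x * f x) \<le> norm (C * (std_normal_density x * \<bar>x\<bar> ^ 0 + 3 * (std_normal_density x * \<bar>x\<bar> ^ 1)
     + 3 * (std_normal_density x * \<bar>x\<bar> ^ 2) + std_normal_density x * \<bar>x\<bar> ^ 3))"
        by simp
    qed
  qed measurable
qed

text \<open>Since the density \<phi> satisfies \<phi>' = -x \<phi>, the function -x f \<phi> has
  derivative (x^2 - 1) f \<phi> - x f' \<phi>. Its boundary values are 0, so the two integrals
  agree. Only one derivative of \<open>f\<close> enters.\<close>

lemma std_normal_second_Stein:
  fixes f f' :: "real \<Rightarrow> real"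
  assumes f: "\<And>x. (f has_real_derivative f' x) (at x)" and f': "\<And>x. isCont f' x"
    and bound: "\<And>x. \<bar>f' x\<bar> \<le> 1"
  shows "(\<integral>x. std_normal_density x * ((x\<^sup>2 - 1) * f x) \<partial>lborel) = (\<integral>x. std_normal_density x * (x * f' x) \<partial>lborel)"
proof -
  have f_bound: "\<bar>f x\<bar> \<le> (1 + \<bar>f 0\<bar>) * (1 + \<bar>x\<bar>)" for x
  proof -
    \<comment> \<open>A derivative bounded by 1 makes \<open>f\<close> 1-Lipschitz, hence of linear
      growth.\<close>
    have "norm (f x - f 0) \<le> 1 * norm (x - 0)"
      by (rule field_differentiable_bound[of UNIV])
        (use f bound in \<open>auto intro: has_field_derivative_at_within\<close>)
    then have "\<bar>f x\<bar> \<le> \<bar>f 0\<bar> + \<bar>x\<bar>" by simp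
    also have "\<dots> \<le> (1 + \<bar>f 0\<bar>) * (1 + \<bar>x\<bar>)" by (simp add: algebra_simps)
    finally show ?thesis .
  qed
  have f_cont: "isCont f x" for x
    using f DERIV_isCont by blast
  have [measurable]: "f \<in> borel_measurable borel" "f' \<in> borel_measurable borel"
    by (auto intro!: borel_measurable_continuous_onI continuous_at_imp_continuous_on f_cont f')
  have int1: "integrable lborel (\<lambda>x. std_normal_density x * ((x\<^sup>2 - 1) * f x))"
  proof (rule integrable_std_normal_abs_bound)
    fix x :: real
    have "\<bar>x\<^sup>2 - 1\<bar> \<le> x\<^sup>2 + 1" by (auto simp: abs_le_iff)
    also have "\<dots> \<le> (1 + \<bar>x\<bar>)\<^sup>2" by (simp add: power2_eq_square algebra_simps)
    finally have "\<bar>(x\<^sup>2 - 1) * f x\<bar> \<le> (1 + \<bar>x\<bar>)\<^sup>2 * ((1 + \<bar>f 0\<bar>) * (1 + \<bar>x\<bar>))"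
      using f_bound[of x] unfolding abs_mult by (intro mult_mono) auto
    also have "\<dots> = (1 + \<bar>f 0\<bar>) * (1 + \<bar>x\<bar>) ^ 3" by (simp add: eval_nat_numeral)
    finally show "\<bar>(x\<^sup>2 - 1) * f x\<bar> \<le> (1 + \<bar>f 0\<bar>) * (1 + \<bar>x\<bar>) ^ 3" .
  qed measurable
  have int2: "integrable lborel (\<lambda>x. std_normal_density x * (x * f' x))"
  proof (rule integrable_std_normal_abs_bound)
    fix x :: real
    have "\<bar>x * f' x\<bar> \<le> \<bar>x\<bar> * 1"
      using bound[of x] unfolding abs_mult by (intro mult_mono) auto
    also have "\<dots> \<le> (1 + \<bar>x\<bar>) ^ 1" by simp
    also have "\<dots> \<le> (1 + \<bar>x\<bar>) ^ 3" by (intro power_increasing) auto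
    finally show "\<bar>x * f' x\<bar> \<le> 1 * (1 + \<bar>x\<bar>) ^ 3" by simp
  qed measurable
  let ?h = "\<lambda>x. std_normal_density x * ((x\<^sup>2 - 1) * f x) - std_normal_density x * (x * f' x)"
  let ?H = "\<lambda>x. - (x * f x * std_normal_density x)"
  have cont_dens: "isCont std_normal_density x" for x
    unfolding std_normal_density_def by (intro continuous_intros) auto
  \<comment> \<open>Stated for an arbitrary filter so that one estimate serves both ends of the real
    line; linear growth of \<open>f\<close> is beaten by the Gaussian factor.\<close>
  have H_lim: "(?H \<longlongrightarrow> 0) F" if F: "((\<lambda>x. \<bar>x\<bar> * (1 + \<bar>x\<bar>) * exp (- x\<^sup>2 / 2)) \<longlongrightarrow> 0) F" for F
  proof (rule Lim_null_comparison)
    show "((\<lambda>x. (1 + \<bar>f 0\<bar>) / sqrt (2 * pi) * (\<bar>x\<bar> * (1 + \<bar>x\<bar>) * exp (- x\<^sup>2 / 2))) \<longlongrightarrow> 0) F"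
      by (rule tendsto_mult_right_zero[OF F])
    have "norm (?H x) \<le> (1 + \<bar>f 0\<bar>) / sqrt (2 * pi) * (\<bar>x\<bar> * (1 + \<bar>x\<bar>) * exp (- x\<^sup>2 / 2))" for x
    proof -
      have "norm (?H x) = \<bar>x\<bar> * \<bar>f x\<bar> * std_normal_density x"
        by (simp add: abs_mult)
      also have "\<dots> \<le> \<bar>x\<bar> * ((1 + \<bar>f 0\<bar>) * (1 + \<bar>x\<bar>)) * std_normal_density x"
        using f_bound[of x] by (intro mult_right_mono mult_left_mono) auto
      finally show ?thesis by (simp add: std_normal_density_def mult_ac)
    qed
    then show "\<forall>\<^sub>F x in F. norm (?H x) \<le> (1 + \<bar>f 0\<bar>) / sqrt (2 * pi) * (\<bar>x\<bar> * (1 + \<bar>x\<bar>) * exp (- x\<^sup>2 / 2))"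
      by simp
  qed
  have "(LBINT x=-\<infinity>..\<infinity>. ?h x) = 0 - 0"
  proof (rule interval_integral_FTC_integrable)
    show "(?H has_vector_derivative ?h x) (at x)" for x
      unfolding std_normal_density_def has_real_derivative_iff_has_vector_derivative[symmetric]
      by (auto intro!: derivative_eq_intros f simp: field_simps power2_eq_square)
    show "isCont ?h x" for x
      by (intro continuous_intros cont_dens f_cont f')
    show "set_integrable lborel (einterval (- \<infinity>) \<infinity>) ?h"
      using int1 int2 by (simp add: set_integrable_def)
    show "((?H \<circ> real_of_ereal) \<longlongrightarrow> 0) (at_right (- \<infinity>))"
      unfolding ereal_tendsto_simps by (rule H_lim) real_asymp
    show "((?H \<circ> real_of_ereal) \<longlongrightarrow> 0) (at_left \<infinity>)"
      unfolding ereal_tendsto_simps by (rule H_lim) real_asymp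
  qed simp
  then have "(\<integral>x. ?h x \<partial>lborel) = 0"
    by (simp add: interval_lebesgue_integral_def set_lebesgue_integral_def)
  then show ?thesis
    using int1 int2 by simp
qed

text \<open>Independence turns the joint law into a product, and Fubini reduces the claim to the
  one-dimensional identity with \<open>R\<close> frozen. The map \<open>h\<close> allows the
  Gaussian variable to be read off from an \<open>X\<close> with values in another space, such as a
  product over a single index.\<close>

lemma (in prob_space) second_Stein_indep:
  fixes F F' :: "real \<Rightarrow> 'b \<Rightarrow> real"
  assumes X: "distributed M lborel (\<lambda>\<omega>. h (X \<omega>)) std_normal_density" and indep: "indep_var S' X S R"
    and [measurable]: "h \<in> borel_measurable S'" "case_prod F \<in> borel_measurable (borel \<Otimes>\<^sub>M S)" "case_prod F' \<in> borel_measurable (borel \<Otimes>\<^sub>M S)"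
    and deriv: "\<And>x r. ((\<lambda>x. F x r) has_real_derivative F' x r) (at x)"
    and cont: "\<And>x r. isCont (\<lambda>x. F' x r) x" and bound: "\<And>x r. \<bar>F' x r\<bar> \<le> 1"
    and int: "integrable M (\<lambda>\<omega>. ((h (X \<omega>))\<^sup>2 - 1) * F (h (X \<omega>)) (R \<omega>))"
      "integrable M (\<lambda>\<omega>. h (X \<omega>) * F' (h (X \<omega>)) (R \<omega>))"
  shows "expectation (\<lambda>\<omega>. ((h (X \<omega>))\<^sup>2 - 1) * F (h (X \<omega>)) (R \<omega>)) =
    expectation (\<lambda>\<omega>. h (X \<omega>) * F' (h (X \<omega>)) (R \<omega>))"
proof -
  define N where "N = distr M S' X"
  define Q where "Q = distr M S R"
  have rv [measurable]: "random_variable S' X" "random_variable S R"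
    using indep by (auto dest: indep_var_rv1 indep_var_rv2)
  have sets_eq [measurable_cong]: "sets N = sets S'" "sets Q = sets S"
    by (simp_all add: N_def Q_def)
  have joint: "distr M (S' \<Otimes>\<^sub>M S) (\<lambda>\<omega>. (X \<omega>, R \<omega>)) = N \<Otimes>\<^sub>M Q"
    using indep unfolding indep_var_distribution_eq N_def Q_def by simp
  interpret N: prob_space N unfolding N_def by (rule prob_space_distr) simp
  interpret Q: prob_space Q unfolding Q_def by (rule prob_space_distr) simp
  interpret NQ: pair_sigma_finite N Q ..
  \<comment> \<open>The Fubini computation for a general integrand \<open>k\<close>, applied below
    to each side of the identity.\<close>
  have eq: "expectation (\<lambda>\<omega>. k (h (X \<omega>)) (R \<omega>)) = (\<integral>r. (\<integral>x. std_normal_density x * k x r \<partial>lborel) \<partial>Q)"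
    if [measurable]: "case_prod k \<in> borel_measurable (borel \<Otimes>\<^sub>M S)"
      and int: "integrable M (\<lambda>\<omega>. k (h (X \<omega>)) (R \<omega>))" for k :: "real \<Rightarrow> 'b \<Rightarrow> real"
  proof -
    have "integrable (N \<Otimes>\<^sub>M Q) (\<lambda>(x, r). k (h x) r)"
      unfolding joint[symmetric] using int by (subst integrable_distr_eq) auto
    then have "(\<integral>r. (\<integral>x. k (h x) r \<partial>N) \<partial>Q) = (\<integral>(x, r). k (h x) r \<partial>(N \<Otimes>\<^sub>M Q))"
      by (rule NQ.integral_snd)
    also have "\<dots> = expectation (\<lambda>\<omega>. k (h (X \<omega>)) (R \<omega>))"
      unfolding joint[symmetric] by (subst integral_distr) auto
    also have "(\<integral>r. (\<integral>x. k (h x) r \<partial>N) \<partial>Q) = (\<integral>r. (\<integral>x. std_normal_density x * k x r \<partial>lborel) \<partial>Q)"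
    proof (rule Bochner_Integration.integral_cong[OF refl])
      fix r assume "r \<in> space Q"
      then have [measurable]: "(\<lambda>x. k x r) \<in> borel_measurable borel"
        by (simp add: Q_def)
      show "(\<integral>x. k (h x) r \<partial>N) = (\<integral>x. std_normal_density x * k x r \<partial>lborel)"
        using distributed_integral[OF X, of "\<lambda>x. k x r"] unfolding N_def
        by (subst integral_distr) auto
    qed
    finally show ?thesis by simp
  qed
  show ?thesis
    using std_normal_second_Stein[OF deriv cont bound] int
      eq[of "\<lambda>x r. (x\<^sup>2 - 1) * F x r"] eq[of "\<lambda>x r. x * F' x r"] by simp
qed

section \<open>Variance bound from a test function\<close>

lemma (in prob_space) variance_ge_test_function:
  fixes F T :: "'a \<Rightarrow> real"
  assumes "integrable M F" "integrable M (\<lambda>x. (F x)\<^sup>2)" "integrable M T" "integrable M (\<lambda>x. (T x)\<^sup>2)"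
    "integrable M (\<lambda>x. F x * T x)" and "expectation T = 0"
  shows "2 * s * expectation (\<lambda>x. F x * T x) - s\<^sup>2 * expectation (\<lambda>x. (T x)\<^sup>2) \<le> variance F"
proof -
  let ?m = "expectation F"
  \<comment> \<open>Cauchy-Schwarz in the form of a nonnegative square with a free multiplier
    \<open>s\<close>, so that nothing is divided by the second moment of \<open>T\<close>.\<close>
  have "0 \<le> expectation (\<lambda>x. (F x - ?m - s * T x)\<^sup>2)"
    by (intro Bochner_Integration.integral_nonneg) auto
  also have "(\<lambda>x. (F x - ?m - s * T x)\<^sup>2) =
     (\<lambda>x. (F x)\<^sup>2 - 2 * ?m * F x + ?m\<^sup>2 - 2 * s * (F x * T x) + 2 * s * ?m * T x + s\<^sup>2 * (T x)\<^sup>2)"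
    by (simp add: power2_eq_square algebra_simps)
  also have "expectation \<dots> = expectation (\<lambda>x. (F x)\<^sup>2) - ?m\<^sup>2 - 2 * s * expectation (\<lambda>x. F x * T x)
      + s\<^sup>2 * expectation (\<lambda>x. (T x)\<^sup>2)"
    using assms by (simp add: prob_space) (simp add: power2_eq_square algebra_simps)
  finally show ?thesis
    using assms(1,2) by (simp add: variance_eq)
qed

subsection \<open>Gibbs averages\<close>

text \<open>The Boltzmann factor exp(-b H). The edge set is a separate argument so that the edges at
  a vertex can be removed from it.\<close>

definition gibbs_weight :: "'v set set \<Rightarrow> real \<Rightarrow> ('v set \<Rightarrow> real) \<Rightarrow> ('v \<Rightarrow> real) \<Rightarrow> real" where
  "gibbs_weight E b g \<sigma> = exp (b * (\<Sum>e\<in>E. g e * (\<Prod>i\<in>e. \<sigma> i)))"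

definition edge_mean :: "'v set \<Rightarrow> 'v set set \<Rightarrow> real \<Rightarrow> 'v set \<Rightarrow> ('v set \<Rightarrow> real) \<Rightarrow> real" where
  "edge_mean V E b e g =
     (\<Sum>\<sigma>\<in>spin_configs V. gibbs_weight E b g \<sigma> * (\<Prod>i\<in>e. \<sigma> i)) / (\<Sum>\<sigma>\<in>spin_configs V. gibbs_weight E b g \<sigma>)"

lemma gibbs_weight_cong:
  assumes "\<And>e. e \<in> E \<Longrightarrow> g e = h e"
  shows "gibbs_weight E b g \<sigma> = gibbs_weight E b h \<sigma>"
  using assms by (simp add: gibbs_weight_def)

lemma gibbs_weight_pos: "0 < gibbs_weight E b g \<sigma>"
  by (simp add: gibbs_weight_def)

lemma finite_spin_configs: "finite V \<Longrightarrow> finite (spin_configs V)"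
  by (simp add: spin_configs_def finite_PiE)

lemma spin_configs_nonempty: "spin_configs V \<noteq> {}"
  by (simp add: spin_configs_def PiE_eq_empty_iff)

lemma abs_prod_spin: "\<bar>\<Prod>i\<in>e. \<sigma> i\<bar> = 1" if "\<sigma> \<in> spin_configs V" "e \<subseteq> V"
proof -
  have "\<bar>\<sigma> i\<bar> = 1" if "i \<in> e" for i
    using \<open>\<sigma> \<in> spin_configs V\<close> \<open>e \<subseteq> V\<close> that by (auto simp: spin_configs_def PiE_def Pi_def)
  then show ?thesis by (simp add: abs_prod)
qed

lemma sum_gibbs_weight_pos: "finite V \<Longrightarrow> 0 < (\<Sum>\<sigma>\<in>spin_configs V. gibbs_weight E b g \<sigma>)"
  by (intro sum_pos finite_spin_configs spin_configs_nonempty gibbs_weight_pos)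

lemma free_energy_ereal:
  "free_energy V E g (ereal b) = 1 / b * ln (\<Sum>\<sigma>\<in>spin_configs V. gibbs_weight E b g \<sigma>)"
  by (simp add: free_energy_def gibbs_weight_def hamiltonian_def)

lemma abs_edge_mean_le_1:
  assumes "finite V" "e \<subseteq> V"
  shows "\<bar>edge_mean V E b e g\<bar> \<le> 1"
proof -
  have "\<bar>\<Sum>\<sigma>\<in>spin_configs V. gibbs_weight E b g \<sigma> * (\<Prod>i\<in>e. \<sigma> i)\<bar>
      \<le> (\<Sum>\<sigma>\<in>spin_configs V. \<bar>gibbs_weight E b g \<sigma> * (\<Prod>i\<in>e. \<sigma> i)\<bar>)"
    by (rule sum_abs)
  also have "\<dots> = (\<Sum>\<sigma>\<in>spin_configs V. gibbs_weight E b g \<sigma>)"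
    using assms by (intro sum.cong refl) (simp add: abs_mult abs_prod_spin gibbs_weight_def)
  finally show ?thesis
    using sum_gibbs_weight_pos[OF assms(1), of E b g] by (simp add: edge_mean_def)
qed

section \<open>Dependence on a single coupling\<close>

lemma sum_fun_upd_eq:
  assumes "finite E" "e \<in> E"
  shows "(\<Sum>e'\<in>E. (g(e := x)) e' * c e') = x * c e + (\<Sum>e'\<in>E - {e}. g e' * (c e' :: real))"
  using assms by (subst sum.remove[of _ e]) (auto intro!: sum.cong)

lemma gibbs_weight_has_derivative:
  assumes "finite E" "e \<in> E"
  shows "((\<lambda>x. gibbs_weight E b (g(e := x)) \<sigma>) has_real_derivative
           b * (gibbs_weight E b (g(e := x)) \<sigma> * (\<Prod>i\<in>e. \<sigma> i))) (at x)"
  unfolding gibbs_weight_def sum_fun_upd_eq[OF assms]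
  by (auto intro!: derivative_eq_intros)

text \<open>Logarithmic differentiation of the partition function gives \<open>b\<close> times the
  Gibbs average of the spin product, and the prefactor 1 / b cancels this \<open>b\<close>.\<close>

lemma free_energy_has_derivative:
  assumes "finite V" "finite E" "e \<in> E" "0 < b"
  shows "((\<lambda>x. free_energy V E (g(e := x)) (ereal b)) has_real_derivative
           edge_mean V E b e (g(e := x))) (at x)"
proof -
  have "((\<lambda>x. \<Sum>\<sigma>\<in>spin_configs V. gibbs_weight E b (g(e := x)) \<sigma>) has_real_derivative
     (\<Sum>\<sigma>\<in>spin_configs V. b * (gibbs_weight E b (g(e := x)) \<sigma> * (\<Prod>i\<in>e. \<sigma> i)))) (at x)"
    by (intro DERIV_sum gibbs_weight_has_derivative assms)
  from DERIV_cmult[OF DERIV_chain2[OF DERIV_ln[OF sum_gibbs_weight_pos[OF assms(1)]] this], of "1 / b"] show ?thesis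
    unfolding free_energy_ereal edge_mean_def
    by (rule DERIV_cong)
      (use sum_gibbs_weight_pos[OF assms(1), of E b "g(e := x)"] \<open>0 < b\<close> in
        \<open>simp add: sum_distrib_left[symmetric] field_simps\<close>)
qed

lemma isCont_edge_mean:
  assumes "finite V" "finite E" "e \<in> E"
  shows "isCont (\<lambda>x. edge_mean V E b e (g(e := x))) x"
proof -
  have "isCont (\<lambda>x. gibbs_weight E b (g(e := x)) \<sigma>) x" for \<sigma>
    using gibbs_weight_has_derivative[OF assms(2,3)] DERIV_isCont by blast
  then show ?thesis
    unfolding edge_mean_def using sum_gibbs_weight_pos[OF assms(1), of E b "g(e := x)"]
    by (intro continuous_intros) auto
qed

section \<open>Spin flips and the edges at one vertex\<close>

lemma prod_flip_spin:
  assumes "finite e"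
  shows "(\<Prod>j\<in>e. (\<sigma>(i := - \<sigma> i)) j) = (if i \<in> e then - (\<Prod>j\<in>e. \<sigma> j) else (\<Prod>j\<in>e. \<sigma> j :: real))"
proof (cases "i \<in> e")
  case True
  have "(\<Prod>j\<in>e - {i}. (\<sigma>(i := - \<sigma> i)) j) = (\<Prod>j\<in>e - {i}. \<sigma> j)"
    by (intro prod.cong) auto
  then show ?thesis
    using True assms by (simp add: prod.remove[of e i])
qed (auto intro!: prod.cong)

lemma sum_flip_spin:
  assumes "i \<in> V"
  shows "(\<Sum>\<sigma>\<in>spin_configs V. f (\<sigma>(i := - \<sigma> i))) = (\<Sum>\<sigma>\<in>spin_configs V. f \<sigma>)"
proof -
  have "\<sigma>(i := - \<sigma> i) \<in> spin_configs V" if "\<sigma> \<in> spin_configs V" for \<sigma>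
    using that assms by (fastforce simp: spin_configs_def PiE_def Pi_def extensional_def)
  then show ?thesis
    by (intro sum.reindex_bij_witness[of _ "\<lambda>\<sigma>. \<sigma>(i := - \<sigma> i)" "\<lambda>\<sigma>. \<sigma>(i := - \<sigma> i)"]) auto
qed

definition local_field :: "'v set set \<Rightarrow> ('v set \<Rightarrow> real) \<Rightarrow> ('v \<Rightarrow> real) \<Rightarrow> real" where
  "local_field S g \<sigma> = (\<Sum>e\<in>S. g e * (\<Prod>i\<in>e. \<sigma> i))"

text \<open>
  Averaging over the flip of the spin at \<open>i\<close> turns the Gibbs average
  \<open>\<langle>Y exp (b Y)\<rangle> / \<langle>exp (b Y)\<rangle>\<close> into \<open>\<langle>Y sinh (b Y)\<rangle> / \<langle>cosh (b Y)\<rangle>\<close>, where \<open>Y\<close> is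
  the local field and the brackets ignore the edges at \<open>i\<close>. Since \<open>Y tanh (c Y)\<close> and
  \<open>cosh (b Y)\<close> both increase with \<open>|Y|\<close>, Chebyshev's inequality removes the weight \<open>cosh (b Y)\<close>.
\<close>

lemma sum_star_edge_mean_ge:
  fixes E :: "'v set set"
  defines "S i \<equiv> {e \<in> E. i \<in> e}"
  assumes V: "finite V" and E: "finite E" "\<And>e. e \<in> E \<Longrightarrow> finite e" and i: "i \<in> V" and c: "0 \<le> c" "c \<le> b"
  shows "(\<Sum>\<sigma>\<in>spin_configs V. gibbs_weight (E - S i) b g \<sigma> /
             (\<Sum>\<tau>\<in>spin_configs V. gibbs_weight (E - S i) b g \<tau>) *
             (local_field (S i) g \<sigma> * tanh (c * local_field (S i) g \<sigma>)))
           \<le> (\<Sum>e\<in>S i. g e * edge_mean V E b e g)"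
proof -
  let ?\<Omega> = "spin_configs V"
  define w where "w = gibbs_weight (E - S i) b g"
  define Y where "Y = local_field (S i) g"
  define flip where "flip = (\<lambda>\<sigma>::'v \<Rightarrow> real. \<sigma>(i := - \<sigma> i))"
  have b: "0 \<le> b" using c by simp
  have S: "S i \<subseteq> E" by (auto simp: S_def)
  \<comment> \<open>The exponent splits into the edges away from \<open>i\<close>, which make up
    \<open>w\<close>, and the local field at \<open>i\<close>.\<close>
  have gibbs: "gibbs_weight E b g \<sigma> = w \<sigma> * exp (b * Y \<sigma>)" for \<sigma>
    using sum.subset_diff[OF S E(1), of "\<lambda>e. g e * (\<Prod>i\<in>e. \<sigma> i)"]
    by (simp add: gibbs_weight_def w_def Y_def local_field_def distrib_left exp_add)
  have w_pos: "0 < w \<sigma>" for \<sigma> by (simp add: w_def gibbs_weight_def)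
  \<comment> \<open>No edge outside the star contains \<open>i\<close>, so the flip leaves
    \<open>w\<close> unchanged; every edge of the star contains \<open>i\<close>, so the flip
    negates \<open>Y\<close>.\<close>
  have w_flip: "w (flip \<sigma>) = w \<sigma>" for \<sigma>
  proof -
    have "(\<Sum>e\<in>E - S i. g e * (\<Prod>j\<in>e. flip \<sigma> j)) = (\<Sum>e\<in>E - S i. g e * (\<Prod>j\<in>e. \<sigma> j))"
      by (intro sum.cong refl) (simp add: S_def flip_def prod_flip_spin E(2) del: fun_upd_apply)
    then show ?thesis by (simp add: w_def gibbs_weight_def)
  qed
  have Y_flip: "Y (flip \<sigma>) = - Y \<sigma>" for \<sigma>
    unfolding Y_def local_field_def sum_negf[symmetric]
    by (intro sum.cong refl) (simp add: S_def flip_def prod_flip_spin E(2) del: fun_upd_apply)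
  have symm: "(\<Sum>\<sigma>\<in>?\<Omega>. w \<sigma> * f (Y \<sigma>)) = (\<Sum>\<sigma>\<in>?\<Omega>. w \<sigma> * ((f (Y \<sigma>) + f (- Y \<sigma>)) / 2))" for f :: "real \<Rightarrow> real"
  proof -
    have "(\<Sum>\<sigma>\<in>?\<Omega>. w \<sigma> * f (Y \<sigma>)) = (\<Sum>\<sigma>\<in>?\<Omega>. w \<sigma> * f (- Y \<sigma>))"
      using sum_flip_spin[OF i, of "\<lambda>\<sigma>. w \<sigma> * f (Y \<sigma>)"] w_flip Y_flip by (simp add: flip_def)
    then show ?thesis
      by (simp add: add_divide_distrib distrib_left sum.distrib sum_divide_distrib[symmetric])
  qed
  have Z: "(\<Sum>\<sigma>\<in>?\<Omega>. gibbs_weight E b g \<sigma>) = (\<Sum>\<sigma>\<in>?\<Omega>. w \<sigma> * cosh (b * Y \<sigma>))"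
    unfolding gibbs using symm[of "\<lambda>y. exp (b * y)"] by (simp add: cosh_field_def)
  have num: "(\<Sum>\<sigma>\<in>?\<Omega>. gibbs_weight E b g \<sigma> * Y \<sigma>) = (\<Sum>\<sigma>\<in>?\<Omega>. w \<sigma> * (Y \<sigma> * sinh (b * Y \<sigma>)))"
    unfolding gibbs using symm[of "\<lambda>y. exp (b * y) * y"]
    by (simp add: sinh_field_def algebra_simps)
  have Z_pos: "0 < (\<Sum>\<sigma>\<in>?\<Omega>. w \<sigma> * cosh (b * Y \<sigma>))"
    using Z sum_gibbs_weight_pos[OF V, of E b g] by simp
  have w_sum_pos: "0 < (\<Sum>\<sigma>\<in>?\<Omega>. w \<sigma>)"
    by (simp add: w_def sum_gibbs_weight_pos[OF V])
  \<comment> \<open>Chebyshev with weights \<open>w\<close> for Y tanh(c Y) and cosh(b Y).\<close>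
  have "(\<Sum>\<sigma>\<in>?\<Omega>. w \<sigma> * (Y \<sigma> * tanh (c * Y \<sigma>))) * (\<Sum>\<sigma>\<in>?\<Omega>. w \<sigma> * cosh (b * Y \<sigma>))
      \<le> (\<Sum>\<sigma>\<in>?\<Omega>. w \<sigma> * (Y \<sigma> * tanh (c * Y \<sigma>)) * cosh (b * Y \<sigma>)) * (\<Sum>\<sigma>\<in>?\<Omega>. w \<sigma>)"
    using w_pos c b by (intro weighted_Chebyshev_sum times_tanh_cosh_comonotone) (auto intro: less_imp_le)
  \<comment> \<open>As \<open>c\<close> is at most \<open>b\<close>, the factor Y tanh(c Y) may be
    raised to Y tanh(b Y), and tanh times cosh is sinh.\<close>
  also have "\<dots> \<le> (\<Sum>\<sigma>\<in>?\<Omega>. w \<sigma> * (Y \<sigma> * sinh (b * Y \<sigma>))) * (\<Sum>\<sigma>\<in>?\<Omega>. w \<sigma>)"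
  proof (intro mult_right_mono sum_mono)
    fix \<sigma>
    have "Y \<sigma> * tanh (c * Y \<sigma>) \<le> Y \<sigma> * tanh (b * Y \<sigma>)"
      unfolding times_tanh_abs[of "Y \<sigma>"] using c by (intro mult_left_mono) (auto intro: mult_right_mono)
    then show "w \<sigma> * (Y \<sigma> * tanh (c * Y \<sigma>)) * cosh (b * Y \<sigma>) \<le> w \<sigma> * (Y \<sigma> * sinh (b * Y \<sigma>))"
      unfolding times_sinh_eq mult.assoc[of "w \<sigma>"] using w_pos[of \<sigma>] 
      by (intro mult_left_mono[OF mult_right_mono]) auto
  qed (use w_sum_pos in simp)
  finally have "(\<Sum>\<sigma>\<in>?\<Omega>. w \<sigma> * (Y \<sigma> * tanh (c * Y \<sigma>))) / (\<Sum>\<sigma>\<in>?\<Omega>. w \<sigma>)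
      \<le> (\<Sum>\<sigma>\<in>?\<Omega>. w \<sigma> * (Y \<sigma> * sinh (b * Y \<sigma>))) / (\<Sum>\<sigma>\<in>?\<Omega>. w \<sigma> * cosh (b * Y \<sigma>))"
    using Z_pos w_sum_pos by (simp add: frac_le_eq divide_simps mult.commute)
  also have "\<dots> = (\<Sum>e\<in>S i. g e * edge_mean V E b e g)"
  proof -
    \<comment> \<open>\<open>Y\<close> is linear in the spin products, so its Gibbs average is the
      sum of the edge means weighted by the couplings.\<close>
    have "(\<Sum>\<sigma>\<in>?\<Omega>. gibbs_weight E b g \<sigma> * Y \<sigma>)
        = (\<Sum>e\<in>S i. \<Sum>\<sigma>\<in>?\<Omega>. g e * (gibbs_weight E b g \<sigma> * (\<Prod>i\<in>e. \<sigma> i)))"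
      by (subst sum.swap) (simp add: Y_def local_field_def sum_distrib_left mult_ac)
    then show ?thesis
      unfolding edge_mean_def num[symmetric] Z[symmetric]
      by (simp add: sum_distrib_left[symmetric] sum_divide_distrib[of _ "S i"])
  qed
  finally show ?thesis
    by (simp add: w_def Y_def sum_divide_distrib)
qed

section \<open>Comparison with the ground state, and counting of edges\<close>

lemma free_energy_infinity_le:
  assumes "finite V" "0 < b"
  shows "free_energy V E g \<infinity> \<le> free_energy V E g (ereal b)"
    and "free_energy V E g (ereal b) \<le> free_energy V E g \<infinity> + ln (real (card (spin_configs V))) / b"
proof -
  let ?\<Omega> = "spin_configs V" and ?K = "\<lambda>\<sigma>. \<Sum>e\<in>E. g e * (\<Prod>i\<in>e. \<sigma> i)"
  let ?Z = "\<Sum>\<sigma>\<in>?\<Omega>. gibbs_weight E b g \<sigma>"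
  note fin = finite_spin_configs[OF assms(1)]
  have inf: "free_energy V E g \<infinity> = Max (?K ` ?\<Omega>)"
    by (simp add: free_energy_def hamiltonian_def)
  have "Max (?K ` ?\<Omega>) \<in> ?K ` ?\<Omega>"
    by (intro Max_in) (use fin spin_configs_nonempty in auto)
  then obtain \<sigma> where \<sigma>: "\<sigma> \<in> ?\<Omega>" "Max (?K ` ?\<Omega>) = ?K \<sigma>" by auto
  have card: "0 < real (card ?\<Omega>)"
    using fin spin_configs_nonempty by (simp add: card_gt_0_iff)
  \<comment> \<open>The partition function lies between its largest term, attained at the maximiser
    \<sigma>, and the number of configurations times that term.\<close>
  have "exp (b * ?K \<sigma>) \<le> ?Z"
    using member_le_sum[of \<sigma> ?\<Omega> "gibbs_weight E b g"] fin \<sigma>(1)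
    by (simp add: gibbs_weight_def)
  then have "b * ?K \<sigma> \<le> ln ?Z"
    using sum_gibbs_weight_pos[OF assms(1), of E b g] by (simp add: ln_ge_iff)
  then show "free_energy V E g \<infinity> \<le> free_energy V E g (ereal b)"
    unfolding inf \<sigma>(2) free_energy_ereal using assms(2) by (simp add: field_simps)
  have "?Z \<le> (\<Sum>\<sigma>'\<in>?\<Omega>. exp (b * ?K \<sigma>))"
    unfolding gibbs_weight_def \<sigma>(2)[symmetric]
    by (intro sum_mono) (use fin assms(2) in \<open>auto intro!: mult_left_mono\<close>)
  then have "ln ?Z \<le> ln (real (card ?\<Omega>) * exp (b * ?K \<sigma>))"
    using sum_gibbs_weight_pos[OF assms(1), of E b g] card by (subst ln_le_cancel_iff) auto
  also have "\<dots> = ln (real (card ?\<Omega>)) + b * ?K \<sigma>"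
    using card by (simp add: ln_mult)
  finally show "free_energy V E g (ereal b) \<le> free_energy V E g \<infinity> + ln (real (card ?\<Omega>)) / b"
    unfolding inf \<sigma>(2) free_energy_ereal using assms(2) by (simp add: field_simps)
qed

lemma abs_free_energy_infinity_le:
  assumes "finite V" "\<And>e. e \<in> E \<Longrightarrow> e \<subseteq> V"
  shows "\<bar>free_energy V E g \<infinity>\<bar> \<le> (\<Sum>e\<in>E. \<bar>g e\<bar>)"
proof -
  let ?K = "\<lambda>\<sigma>. \<Sum>e\<in>E. g e * (\<Prod>i\<in>e. \<sigma> i)"
  have "Max (?K ` spin_configs V) \<in> ?K ` spin_configs V"
    by (intro Max_in) (use finite_spin_configs[OF assms(1)] spin_configs_nonempty in auto)
  then obtain \<sigma> where \<sigma>: "\<sigma> \<in> spin_configs V" "free_energy V E g \<infinity> = ?K \<sigma>"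
    by (auto simp: free_energy_def hamiltonian_def)
  have "\<bar>?K \<sigma>\<bar> \<le> (\<Sum>e\<in>E. \<bar>g e * (\<Prod>i\<in>e. \<sigma> i)\<bar>)" by (rule sum_abs)
  also have "\<dots> = (\<Sum>e\<in>E. \<bar>g e\<bar>)"
    using assms(2) \<sigma>(1) by (intro sum.cong refl) (simp add: abs_mult abs_prod_spin)
  finally show ?thesis using \<sigma>(2) by simp
qed

lemma sum_degree:
  assumes "simple_graph V E"
  shows "(\<Sum>i\<in>V. card {e \<in> E. i \<in> e}) = 2 * card E"
    and "(\<Sum>i\<in>V. \<Sum>e | e \<in> E \<and> i \<in> e. f e) = 2 * (\<Sum>e\<in>E. f e :: real)"
proof -
  have V: "finite V" and E: "\<And>e. e \<in> E \<Longrightarrow> e \<subseteq> V" "\<And>e. e \<in> E \<Longrightarrow> card e = 2"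
    using assms by (auto simp: simple_graph_def)
  have "finite E" using V E(1) by (meson finite_Pow_iff finite_subset PowI subsetI)
  have "{i \<in> V. i \<in> e} = e" if "e \<in> E" for e using E(1)[OF that] by auto
  then show *: "(\<Sum>i\<in>V. \<Sum>e | e \<in> E \<and> i \<in> e. f e) = 2 * (\<Sum>e\<in>E. f e)" for f :: "'a set \<Rightarrow> real"
    using V \<open>finite E\<close> E(2) by (subst sum.swap_restrict) (auto simp: sum_distrib_left)
  have "real (\<Sum>i\<in>V. card {e \<in> E. i \<in> e}) = real (2 * card E)"
    using *[of "\<lambda>_. 1"] by simp
  then show "(\<Sum>i\<in>V. card {e \<in> E. i \<in> e}) = 2 * card E"
    by (simp only: of_nat_eq_iff)
qed

subsection \<open>Gaussian couplings\<close>

locale spin_glass = prob_space M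
  for M :: "'w measure" +
  fixes V :: "'v set" and E :: "'v set set" and g :: "'v set \<Rightarrow> 'w \<Rightarrow> real"
  assumes graph: "simple_graph V E" and iid: "iid_std_gaussian M E g"
begin

lemma finite_V: "finite V" and edge_subset: "e \<in> E \<Longrightarrow> e \<subseteq> V" and edge_card: "e \<in> E \<Longrightarrow> card e = 2"
  using graph by (auto simp: simple_graph_def)

lemma finite_E: "finite E"
  using finite_V edge_subset by (meson finite_Pow_iff finite_subset PowI subsetI)

lemma finite_edge: "e \<in> E \<Longrightarrow> finite e"
  using finite_V edge_subset finite_subset by blast

lemma indep: "indep_vars (\<lambda>_. borel) g E" and gaussian: "e \<in> E \<Longrightarrow> distributed M lborel (g e) std_normal_density"
  using iid by (auto simp: iid_std_gaussian_def)

lemma measurable_coupling [measurable]: "e \<in> E \<Longrightarrow> g e \<in> borel_measurable M"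
  using distributed_measurable[OF gaussian] by simp

section \<open>Integrability through a common majorant\<close>

abbreviation coupling :: "'w \<Rightarrow> 'v set \<Rightarrow> real" where "coupling \<omega> \<equiv> (\<lambda>e. g e \<omega>)"

text \<open>A majorant for all random quantities below. The summand 1 keeps it at least 1, so that
  constants can be absorbed into its powers.\<close>

definition size_bound :: "'w \<Rightarrow> real" where "size_bound \<omega> = 1 + (\<Sum>e\<in>E. \<bar>g e \<omega>\<bar>)"

lemma size_bound_ge_1: "1 \<le> size_bound \<omega>"
  by (simp add: size_bound_def sum_nonneg)

lemma abs_coupling_le: "e \<in> E \<Longrightarrow> \<bar>g e \<omega>\<bar> \<le> size_bound \<omega>"
  using member_le_sum[of e E "\<lambda>e. \<bar>g e \<omega>\<bar>"] finite_E by (simp add: size_bound_def)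

lemma integrable_size_bound_power: "integrable M (\<lambda>\<omega>. size_bound \<omega> ^ n)"
proof (rule Bochner_Integration.integrable_bound)
  have "integrable M (\<lambda>\<omega>. \<bar>g e \<omega>\<bar> ^ n)" if "e \<in> E" for e
    using integrable_std_normal_moment_abs[of n] distributed_integrable[OF gaussian[OF that], of "\<lambda>x. \<bar>x\<bar> ^ n"]
    by simp
  then show "integrable M (\<lambda>\<omega>. (1 + real (card E)) ^ n * (1 + (\<Sum>e\<in>E. \<bar>g e \<omega>\<bar> ^ n)))"
    by auto
  show "(\<lambda>\<omega>. size_bound \<omega> ^ n) \<in> borel_measurable M"
    unfolding size_bound_def by measurable
  show "AE \<omega> in M. norm (size_bound \<omega> ^ n) \<le> norm ((1 + real (card E)) ^ n * (1 + (\<Sum>e\<in>E. \<bar>g e \<omega>\<bar> ^ n)))"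
  proof (rule AE_I2)
    fix \<omega>
    \<comment> \<open>The maximum of 1 and all the \<bar>g e \<omega>\<bar>. It controls
      \<open>size_bound\<close> up to the factor 1 + card E, and its power is itself one of the
      terms of 1 + (\<Sum>e\<in>E. \<bar>g e \<omega>\<bar> ^ n).\<close>
    define m where "m = Max (insert 1 ((\<lambda>e. \<bar>g e \<omega>\<bar>) ` E))"
    have "m = 1 \<or> (\<exists>e\<in>E. m = \<bar>g e \<omega>\<bar>)"
      using Max_in[of "insert 1 ((\<lambda>e. \<bar>g e \<omega>\<bar>) ` E)"] finite_E by (auto simp: m_def)
    then have "m ^ n \<le> 1 + (\<Sum>e\<in>E. \<bar>g e \<omega>\<bar> ^ n)"
    proof
      assume "m = 1"
      then show ?thesis by (simp add: sum_nonneg)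
    next
      assume "\<exists>e\<in>E. m = \<bar>g e \<omega>\<bar>"
      then obtain e where "e \<in> E" "m = \<bar>g e \<omega>\<bar>" by blast
      then show ?thesis
        using member_le_sum[of e E "\<lambda>e. \<bar>g e \<omega>\<bar> ^ n"] finite_E by simp
    qed
    moreover have m: "1 \<le> m" "\<And>e. e \<in> E \<Longrightarrow> \<bar>g e \<omega>\<bar> \<le> m"
      using finite_E by (auto simp: m_def)
    have "size_bound \<omega> \<le> (1 + real (card E)) * m"
      using m sum_bounded_above[of E "\<lambda>e. \<bar>g e \<omega>\<bar>" m] by (simp add: size_bound_def distrib_right)
    then have "size_bound \<omega> ^ n \<le> (1 + real (card E)) ^ n * m ^ n"
      using size_bound_ge_1[of \<omega>] unfolding power_mult_distrib[symmetric] by (intro power_mono) auto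
    ultimately have "size_bound \<omega> ^ n \<le> (1 + real (card E)) ^ n * (1 + (\<Sum>e\<in>E. \<bar>g e \<omega>\<bar> ^ n))"
      by (elim order_trans) (auto intro: mult_left_mono)
    then show "norm (size_bound \<omega> ^ n) \<le> norm ((1 + real (card E)) ^ n * (1 + (\<Sum>e\<in>E. \<bar>g e \<omega>\<bar> ^ n)))"
      using size_bound_ge_1[of \<omega>] by (simp add: abs_of_nonneg)
  qed
qed

lemma integrable_size_boundI:
  assumes "f \<in> borel_measurable M" "\<And>\<omega>. \<bar>f \<omega>\<bar> \<le> C * size_bound \<omega> ^ n"
  shows "integrable M f"
proof (rule Bochner_Integration.integrable_bound)
  show "integrable M (\<lambda>\<omega>. C * size_bound \<omega> ^ n)"
    by (intro integrable_mult_right integrable_size_bound_power)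
  show "AE \<omega> in M. norm (f \<omega>) \<le> norm (C * size_bound \<omega> ^ n)"
    using assms(2) by (auto intro: order_trans[OF _ abs_ge_self])
qed (rule assms(1))

text \<open>Bounds of this shape are closed under products, so integrability of a product follows
  from bounds on its factors.\<close>

lemma abs_mult_size_bound:
  assumes "\<bar>x\<bar> \<le> C * size_bound \<omega> ^ m" "\<bar>y\<bar> \<le> D * size_bound \<omega> ^ n"
  shows "\<bar>x * y\<bar> \<le> (C * D) * size_bound \<omega> ^ (m + n)"
proof -
  have "0 \<le> C * size_bound \<omega> ^ m"
    using assms(1) by linarith
  then have "\<bar>x * y\<bar> \<le> (C * size_bound \<omega> ^ m) * (D * size_bound \<omega> ^ n)"
    unfolding abs_mult using assms by (intro mult_mono) auto
  then show ?thesis by (simp add: power_add mult_ac)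
qed

lemma abs_square_minus_1_le: "e \<in> E \<Longrightarrow> \<bar>(g e \<omega>)\<^sup>2 - 1\<bar> \<le> 1 * size_bound \<omega> ^ 2"
proof -
  assume "e \<in> E"
  then have "(g e \<omega>)\<^sup>2 \<le> (size_bound \<omega>)\<^sup>2" "1 \<le> (size_bound \<omega>)\<^sup>2"
    using abs_coupling_le[of e \<omega>] size_bound_ge_1[of \<omega>] by (auto simp: abs_le_square_iff[symmetric])
  moreover have "0 \<le> (g e \<omega>)\<^sup>2" by simp
  ultimately show ?thesis unfolding abs_le_iff by linarith
qed

section \<open>The test function and its moments\<close>

definition test_fun :: "'w \<Rightarrow> real" where "test_fun \<omega> = (\<Sum>e\<in>E. (g e \<omega>)\<^sup>2 - 1)"

lemma measurable_test_fun [measurable]: "test_fun \<in> borel_measurable M"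
  unfolding test_fun_def by measurable

lemma abs_test_fun_le: "\<bar>test_fun \<omega>\<bar> \<le> real (card E) * size_bound \<omega> ^ 2"
proof -
  have "\<bar>test_fun \<omega>\<bar> \<le> (\<Sum>e\<in>E. \<bar>(g e \<omega>)\<^sup>2 - 1\<bar>)"
    unfolding test_fun_def by (rule sum_abs)
  also have "\<dots> \<le> real (card E) * (1 * size_bound \<omega> ^ 2)"
    by (intro sum_bounded_above abs_square_minus_1_le)
  finally show ?thesis by simp
qed

lemma integrable_square_minus_1: "e \<in> E \<Longrightarrow> integrable M (\<lambda>\<omega>. (g e \<omega>)\<^sup>2 - 1)"
  by (rule integrable_size_boundI[OF _ abs_square_minus_1_le]) measurable

lemma gaussian_expectation:
  assumes "e \<in> E" "f \<in> borel_measurable borel"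
  shows "expectation (\<lambda>\<omega>. f (g e \<omega>)) = (\<integral>x. std_normal_density x * f x \<partial>lborel)"
  using distributed_integral[OF gaussian[OF assms(1)], of f] assms(2) by simp

lemma expectation_square_minus_1: "e \<in> E \<Longrightarrow> expectation (\<lambda>\<omega>. (g e \<omega>)\<^sup>2 - 1) = 0"
  using gaussian_expectation[of e "\<lambda>x. x\<^sup>2 - 1"] integral_std_normal_moment_even[of 1] integrable_std_normal_moment[of 2]
  by (simp add: right_diff_distrib)

text \<open>x^2 - 1 is the second Hermite polynomial. On the diagonal the moments 3, 1 and 1 give 3
  - 2 + 1 = 2; for distinct edges the factors are independent and centred.\<close>

lemma expectation_square_minus_1_mult:
  assumes "e \<in> E" "e' \<in> E"
  shows "expectation (\<lambda>\<omega>. ((g e \<omega>)\<^sup>2 - 1) * ((g e' \<omega>)\<^sup>2 - 1)) = (if e = e' then 2 else 0)"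
proof (cases "e = e'")
  case True
  have "(\<lambda>x::real. std_normal_density x * ((x\<^sup>2 - 1) * (x\<^sup>2 - 1))) =
      (\<lambda>x. std_normal_density x * x ^ 4 - 2 * (std_normal_density x * x ^ 2) + std_normal_density x)"
    by (simp add: eval_nat_numeral algebra_simps)
  then show ?thesis
    using True assms gaussian_expectation[of e "\<lambda>x. (x\<^sup>2 - 1) * (x\<^sup>2 - 1)"]
      integral_std_normal_moment_even[of 1] integral_std_normal_moment_even[of 2]
      integrable_std_normal_moment[of 2] integrable_std_normal_moment[of 4]
    by (simp add: fact_numeral)
next
  case False
  have "indep_var borel ((\<lambda>f. (f e)\<^sup>2 - 1) \<circ> (\<lambda>\<omega>. restrict (\<lambda>i. g i \<omega>) {e}))
      borel ((\<lambda>f. (f e')\<^sup>2 - 1) \<circ> (\<lambda>\<omega>. restrict (\<lambda>i. g i \<omega>) {e'}))"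
    using assms False by (intro indep_var_compose[OF indep_var_restrict[OF indep]]) auto
  then have "indep_var borel (\<lambda>\<omega>. (g e \<omega>)\<^sup>2 - 1) borel (\<lambda>\<omega>. (g e' \<omega>)\<^sup>2 - 1)"
    by (simp add: comp_def)
  then show ?thesis
    using False assms indep_var_lebesgue_integral[of "\<lambda>\<omega>. (g e \<omega>)\<^sup>2 - 1" "\<lambda>\<omega>. (g e' \<omega>)\<^sup>2 - 1"]
    by (simp only: integrable_square_minus_1 expectation_square_minus_1) simp
qed

lemma expectation_test_fun: "expectation test_fun = 0"
  unfolding test_fun_def by (subst Bochner_Integration.integral_sum)
    (auto simp only: integrable_square_minus_1 expectation_square_minus_1 sum.neutral_const intro!: sum.neutral)

lemma expectation_test_fun_square: "expectation (\<lambda>\<omega>. (test_fun \<omega>)\<^sup>2) = 2 * real (card E)"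
proof -
  have int: "integrable M (\<lambda>\<omega>. ((g e \<omega>)\<^sup>2 - 1) * ((g e' \<omega>)\<^sup>2 - 1))" if "e \<in> E" "e' \<in> E" for e e'
    by (rule integrable_size_boundI[OF _ abs_mult_size_bound[OF abs_square_minus_1_le abs_square_minus_1_le]])
      (use that in auto)
  have "expectation (\<lambda>\<omega>. (test_fun \<omega>)\<^sup>2) =
      expectation (\<lambda>\<omega>. \<Sum>e\<in>E. \<Sum>e'\<in>E. ((g e \<omega>)\<^sup>2 - 1) * ((g e' \<omega>)\<^sup>2 - 1))"
    by (simp only: test_fun_def power2_eq_square[of "sum _ _"] sum_product)
  also have "\<dots> = (\<Sum>e\<in>E. \<Sum>e'\<in>E. if e = e' then 2 else 0)"
    by (simp only: Bochner_Integration.integral_sum Bochner_Integration.integrable_sum int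
        expectation_square_minus_1_mult cong: sum.cong)
  also have "\<dots> = 2 * real (card E)"
    using finite_E by simp
  finally show ?thesis .
qed

section \<open>Measurability and size of free energies and edge means\<close>

lemma measurable_gibbs_weight:
  "S \<subseteq> E \<Longrightarrow> (\<lambda>\<omega>. gibbs_weight S b (coupling \<omega>) \<sigma>) \<in> borel_measurable M"
  unfolding gibbs_weight_def
  by (intro borel_measurable_exp[THEN measurable_compose_rev] borel_measurable_times borel_measurable_sum
      borel_measurable_const measurable_coupling) auto

lemma measurable_free_energy [measurable]:
  "(\<lambda>\<omega>. free_energy V E (coupling \<omega>) (ereal b)) \<in> borel_measurable M"
proof -
  note [measurable] = measurable_gibbs_weight[OF order_refl]
  show ?thesis unfolding free_energy_ereal by measurable
qed

lemma measurable_free_energy_infinity [measurable]: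
  "(\<lambda>\<omega>. free_energy V E (coupling \<omega>) \<infinity>) \<in> borel_measurable M"
proof -
  have "(\<lambda>\<omega>. Max ((\<lambda>\<sigma>. \<Sum>e\<in>E. g e \<omega> * (\<Prod>i\<in>e. \<sigma> i)) ` spin_configs V)) \<in> borel_measurable M"
    using finite_spin_configs[OF finite_V] by measurable
  then show ?thesis by (simp add: free_energy_def hamiltonian_def)
qed

lemma measurable_edge_mean [measurable]:
  "(\<lambda>\<omega>. edge_mean V E b e (coupling \<omega>)) \<in> borel_measurable M"
proof -
  note [measurable] = measurable_gibbs_weight[OF order_refl]
  show ?thesis unfolding edge_mean_def by measurable
qed

lemma abs_free_energy_infinity_size_bound: "\<bar>free_energy V E (coupling \<omega>) \<infinity>\<bar> \<le> 1 * size_bound \<omega> ^ 1"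
  using abs_free_energy_infinity_le[OF finite_V edge_subset, of E "coupling \<omega>"] by (simp add: size_bound_def)

lemma abs_free_energy_size_bound:
  assumes "0 < b"
  shows "\<bar>free_energy V E (coupling \<omega>) (ereal b)\<bar> \<le> (1 + ln (real (card (spin_configs V))) / b) * size_bound \<omega> ^ 1"
proof -
  \<comment> \<open>At least one configuration exists, so the logarithm is nonnegative; the offset
    is then absorbed because \<open>size_bound\<close> is at least 1.\<close>
  have "1 \<le> card (spin_configs V)"
    using finite_spin_configs[OF finite_V] spin_configs_nonempty by (simp add: Suc_le_eq card_gt_0_iff)
  then have "0 \<le> ln (real (card (spin_configs V))) / b"
    using assms by simp
  then have "ln (real (card (spin_configs V))) / b \<le> ln (real (card (spin_configs V))) / b * size_bound \<omega>"
    using mult_left_mono[OF size_bound_ge_1[of \<omega>]] by fastforce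
  then show ?thesis
    using free_energy_infinity_le[OF finite_V assms, of E "coupling \<omega>"] abs_free_energy_infinity_size_bound[of \<omega>]
      \<open>0 \<le> ln _ / b\<close>
    by (simp add: algebra_simps)
qed

lemma integrable_edge_mean:
  assumes e: "e \<in> E"
  shows "integrable M (\<lambda>\<omega>. g e \<omega> * edge_mean V E b e (coupling \<omega>))"
proof (rule integrable_size_boundI)
  show "(\<lambda>\<omega>. g e \<omega> * edge_mean V E b e (coupling \<omega>)) \<in> borel_measurable M"
    using e by measurable
  show "\<bar>g e \<omega> * edge_mean V E b e (coupling \<omega>)\<bar> \<le> 1 * size_bound \<omega> ^ 1" for \<omega>
    using mult_mono[OF abs_coupling_le[OF e] abs_edge_mean_le_1[OF finite_V edge_subset[OF e]]]
      size_bound_ge_1[of \<omega>] by (simp add: abs_mult)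
qed

section \<open>Integration by parts in one coupling\<close>

lemma measurable_gibbs_weight_pair:
  assumes "e \<in> E"
  shows "(\<lambda>p. gibbs_weight E b ((snd p)(e := fst p)) \<sigma>)
    \<in> borel_measurable (borel \<Otimes>\<^sub>M PiM (E - {e}) (\<lambda>_. borel))"
  unfolding gibbs_weight_def sum_fun_upd_eq[OF finite_E assms] by measurable

text \<open>The coupling at \<open>e\<close> is independent of the family \<open>R\<close> of all
  the others. With \<open>R\<close> frozen, the derivative of the free energy in that coupling is
  the edge mean, which is continuous and bounded by 1.\<close>

lemma Stein_free_energy:
  assumes e: "e \<in> E" and b: "0 < b"
  shows "expectation (\<lambda>\<omega>. ((g e \<omega>)\<^sup>2 - 1) * free_energy V E (coupling \<omega>) (ereal b)) =
    expectation (\<lambda>\<omega>. g e \<omega> * edge_mean V E b e (coupling \<omega>))"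
proof -
  define R where "R = (\<lambda>\<omega>. restrict (coupling \<omega>) (E - {e}))"
  have weight: "gibbs_weight E b ((R \<omega>)(e := g e \<omega>)) \<sigma> = gibbs_weight E b (coupling \<omega>) \<sigma>" for \<omega> \<sigma>
    by (rule gibbs_weight_cong) (simp add: R_def)
  have F: "free_energy V E ((R \<omega>)(e := g e \<omega>)) (ereal b) = free_energy V E (coupling \<omega>) (ereal b)" for \<omega>
    by (simp add: free_energy_ereal weight)
  have m: "edge_mean V E b e ((R \<omega>)(e := g e \<omega>)) = edge_mean V E b e (coupling \<omega>)" for \<omega>
    by (simp add: edge_mean_def weight)
  \<comment> \<open>Independence of subfamilies concerns restricted functions, so the single
    coupling is wrapped as a function on {e} and recovered by evaluation at
    \<open>e\<close>.\<close>
  define X where "X = (\<lambda>\<omega>. restrict (coupling \<omega>) {e})"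
  have ind: "indep_var (PiM {e} (\<lambda>_. borel)) X (PiM (E - {e}) (\<lambda>_. borel)) R"
    unfolding R_def X_def using e by (intro indep_var_restrict[OF indep]) auto
  have X: "X \<omega> e = g e \<omega>" for \<omega> by (simp add: X_def)
  have "expectation (\<lambda>\<omega>. ((g e \<omega>)\<^sup>2 - 1) * free_energy V E ((R \<omega>)(e := g e \<omega>)) (ereal b)) =
    expectation (\<lambda>\<omega>. g e \<omega> * edge_mean V E b e ((R \<omega>)(e := g e \<omega>)))"
  proof (rule second_Stein_indep[where h = "\<lambda>x. x e", OF _ ind, unfolded X])
    note [measurable] = measurable_gibbs_weight_pair[OF e]
    show "(\<lambda>(x, r). free_energy V E (r(e := x)) (ereal b)) \<in> borel_measurable (borel \<Otimes>\<^sub>M PiM (E - {e}) (\<lambda>_. borel))"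
      unfolding free_energy_ereal split_beta' by measurable
    show "(\<lambda>(x, r). edge_mean V E b e (r(e := x))) \<in> borel_measurable (borel \<Otimes>\<^sub>M PiM (E - {e}) (\<lambda>_. borel))"
      unfolding edge_mean_def split_beta' by measurable
    show "integrable M (\<lambda>\<omega>. ((g e \<omega>)\<^sup>2 - 1) * free_energy V E ((R \<omega>)(e := g e \<omega>)) (ereal b))"
      unfolding F
      by (rule integrable_size_boundI[OF _ abs_mult_size_bound[OF abs_square_minus_1_le abs_free_energy_size_bound]])
        (use e b in auto)
    show "integrable M (\<lambda>\<omega>. g e \<omega> * edge_mean V E b e ((R \<omega>)(e := g e \<omega>)))"
      unfolding m by (rule integrable_edge_mean[OF e])
    show "distributed M lborel (g e) std_normal_density"
      by (rule gaussian[OF e])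
    show "((\<lambda>x. free_energy V E (r(e := x)) (ereal b)) has_real_derivative edge_mean V E b e (r(e := x))) (at x)" for x r
      by (rule free_energy_has_derivative[OF finite_V finite_E e b])
    show "isCont (\<lambda>x. edge_mean V E b e (r(e := x))) x" for x r
      by (rule isCont_edge_mean[OF finite_V finite_E e])
    show "\<bar>edge_mean V E b e (r(e := x))\<bar> \<le> 1" for x r
      by (rule abs_edge_mean_le_1[OF finite_V edge_subset[OF e]])
  qed simp
  then show ?thesis
    unfolding F m .
qed

section \<open>Law of the local field and the bound for one vertex\<close>

lemma local_field_distributed:
  assumes "S \<subseteq> E" "S \<noteq> {}" "\<sigma> \<in> spin_configs V"
  shows "distributed M lborel (\<lambda>\<omega>. local_field S (coupling \<omega>) \<sigma>) (normal_density 0 (sqrt (real (card S))))"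
proof -
  have "indep_vars (\<lambda>_. borel) g S"
    using indep assms(1) by (rule indep_vars_subset)
  then have "indep_vars (\<lambda>_. borel) (\<lambda>e \<omega>. g e \<omega> * (\<Prod>i\<in>e. \<sigma> i)) S"
    by (rule indep_vars_compose2) simp
  moreover have "distributed M lborel (\<lambda>\<omega>. g e \<omega> * (\<Prod>i\<in>e. \<sigma> i)) std_normal_density" if "e \<in> S" for e
  proof -
    have abs: "\<bar>\<Prod>i\<in>e. \<sigma> i\<bar> = 1"
      using that assms edge_subset by (intro abs_prod_spin[of _ V]) auto
    \<comment> \<open>For a fixed configuration the spin product is a sign, and multiplication by a
      sign preserves the standard Gaussian law.\<close>
    have "distributed M lborel (\<lambda>\<omega>. 0 + (\<Prod>i\<in>e. \<sigma> i) * g e \<omega>)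
        (normal_density (0 + (\<Prod>i\<in>e. \<sigma> i) * 0) (\<bar>\<Prod>i\<in>e. \<sigma> i\<bar> * 1))"
      by (rule normal_density_affine) (use that assms(1) gaussian abs in auto)
    then show ?thesis using abs by (simp add: mult.commute)
  qed
  ultimately show ?thesis
    using sum_indep_normal[of S "\<lambda>e \<omega>. g e \<omega> * (\<Prod>i\<in>e. \<sigma> i)" "\<lambda>_. 1" "\<lambda>_. 0"] assms finite_E
    by (auto simp: local_field_def dest: finite_subset)
qed

lemma abs_local_field_le:
  assumes "S \<subseteq> E" "\<sigma> \<in> spin_configs V"
  shows "\<bar>local_field S (coupling \<omega>) \<sigma>\<bar> \<le> size_bound \<omega>"
proof -
  have "\<bar>local_field S (coupling \<omega>) \<sigma>\<bar> \<le> (\<Sum>e\<in>S. \<bar>g e \<omega> * (\<Prod>i\<in>e. \<sigma> i)\<bar>)"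
    unfolding local_field_def by (rule sum_abs)
  also have "\<dots> = (\<Sum>e\<in>S. \<bar>g e \<omega>\<bar>)"
    using abs_prod_spin[OF assms(2) edge_subset] assms(1)
    by (intro sum.cong refl) (simp add: abs_mult subset_iff)
  also have "\<dots> \<le> (\<Sum>e\<in>E. \<bar>g e \<omega>\<bar>)"
    using assms finite_E by (intro sum_mono2) auto
  finally show ?thesis by (simp add: size_bound_def)
qed

lemma integrable_local_field_power:
  assumes "S \<subseteq> E" "\<sigma> \<in> spin_configs V"
  shows "integrable M (\<lambda>\<omega>. local_field S (coupling \<omega>) \<sigma> ^ n)"
proof (rule integrable_size_boundI)
  show "(\<lambda>\<omega>. local_field S (coupling \<omega>) \<sigma> ^ n) \<in> borel_measurable M"
    unfolding local_field_def using assms(1)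
    by (intro borel_measurable_power borel_measurable_sum borel_measurable_times
        borel_measurable_const measurable_coupling) auto
  show "\<bar>local_field S (coupling \<omega>) \<sigma> ^ n\<bar> \<le> 1 * size_bound \<omega> ^ n" for \<omega>
    using abs_local_field_le[OF assms, of \<omega>] by (simp add: power_abs power_mono)
qed

lemma expectation_local_field:
  assumes "S \<subseteq> E" "\<sigma> \<in> spin_configs V"
  shows "expectation (\<lambda>\<omega>. c * (local_field S (coupling \<omega>) \<sigma>)\<^sup>2 - c ^ 3 * local_field S (coupling \<omega>) \<sigma> ^ 4 / 3) =
    c * real (card S) - c ^ 3 * (real (card S))\<^sup>2"
\<comment> \<open>The empty star has local field 0 and is treated apart, since the Gaussian moment
  formulas require positive standard deviation.\<close>
proof (cases "S = {}")
  case True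
  then show ?thesis by (simp add: local_field_def)
next
  case False
  let ?s = "sqrt (real (card S))"
  have s: "0 < ?s"
    using False assms(1) finite_E by (simp add: card_gt_0_iff finite_subset)
  have D: "expectation (\<lambda>\<omega>. local_field S (coupling \<omega>) \<sigma> ^ n) = (\<integral>x. normal_density 0 ?s x * x ^ n \<partial>lborel)" for n
    using distributed_integral[OF local_field_distributed[OF assms(1) False assms(2)], of "\<lambda>x. x ^ n"] by simp
  have "expectation (\<lambda>\<omega>. (local_field S (coupling \<omega>) \<sigma>)\<^sup>2) = real (card S)"
    using integral_normal_moment_even[OF s, of 0 1] D[of 2] s by simp
  \<comment> \<open>The fourth moment of a centred Gaussian of variance k is 3 k^2; this 3 cancels
    the denominator of the cubic term.\<close>
  moreover have "expectation (\<lambda>\<omega>. local_field S (coupling \<omega>) \<sigma> ^ 4) = 3 * (real (card S))\<^sup>2"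
    using integral_normal_moment_even[OF s, of 0 2] D[of 4] s by (simp add: fact_numeral power_divide)
  ultimately show ?thesis
    using integrable_local_field_power[OF assms] by simp
qed

text \<open>The weights \<open>q\<close> see only couplings off the star, the field \<open>Y\<close>
  only those in it, so the expectation of each product factors. The mean of p(Y) is the same for
  every configuration, and the weights sum to 1.\<close>

lemma expectation_star_ge:
  defines "S i \<equiv> {e \<in> E. i \<in> e}"
  assumes i: "i \<in> V" and c: "0 \<le> c" "c \<le> b" and small: "4 * (c\<^sup>2 * real (card (S i))) \<le> 1"
  shows "3 / 4 * c * real (card (S i)) \<le> expectation (\<lambda>\<omega>. \<Sum>e\<in>S i. g e \<omega> * edge_mean V E b e (coupling \<omega>))"
proof -
  let ?\<Omega> = "spin_configs V"
  define q where "q \<sigma> h = gibbs_weight (E - S i) b h \<sigma> / (\<Sum>\<tau>\<in>?\<Omega>. gibbs_weight (E - S i) b h \<tau>)" for \<sigma> h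
  define p where "p y = c * y\<^sup>2 - c ^ 3 * y ^ 4 / 3" for y :: real
  define Y where "Y \<sigma> \<omega> = local_field (S i) (coupling \<omega>) \<sigma>" for \<sigma> \<omega>
  have S: "S i \<subseteq> E" by (auto simp: S_def)
  have Z_pos: "0 < (\<Sum>\<tau>\<in>?\<Omega>. gibbs_weight (E - S i) b h \<tau>)" for h
    by (rule sum_gibbs_weight_pos[OF finite_V])
  have q_nonneg: "0 \<le> q \<sigma> h" for \<sigma> h
    unfolding q_def using Z_pos[of h] gibbs_weight_pos[of "E - S i" b h \<sigma>] by simp
  have q_sum: "(\<Sum>\<sigma>\<in>?\<Omega>. q \<sigma> h) = 1" for h
    unfolding q_def using Z_pos[of h] by (simp add: sum_divide_distrib[symmetric])
  have q_le: "q \<sigma> h \<le> 1" if "\<sigma> \<in> ?\<Omega>" for \<sigma> h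
    using member_le_sum[of \<sigma> ?\<Omega> "\<lambda>\<sigma>. q \<sigma> h"] that q_nonneg q_sum[of h] finite_spin_configs[OF finite_V] by simp
  have q_meas [measurable]: "(\<lambda>\<omega>. q \<sigma> (coupling \<omega>)) \<in> borel_measurable M" for \<sigma>
    unfolding q_def
    by (intro borel_measurable_divide borel_measurable_sum measurable_gibbs_weight Diff_subset)
  have q_int: "integrable M (\<lambda>\<omega>. q \<sigma> (coupling \<omega>))" if "\<sigma> \<in> ?\<Omega>" for \<sigma>
    by (rule integrable_size_boundI[of _ 1 0]) (use q_le[OF that] q_nonneg in auto)
  have p_int: "integrable M (\<lambda>\<omega>. p (Y \<sigma> \<omega>))" if "\<sigma> \<in> ?\<Omega>" for \<sigma>
    unfolding p_def Y_def using integrable_local_field_power[OF S that] by simp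
  have ind: "indep_var borel (\<lambda>\<omega>. q \<sigma> (coupling \<omega>)) borel (\<lambda>\<omega>. p (Y \<sigma> \<omega>))" for \<sigma>
  proof -
    have "indep_var borel (q \<sigma> \<circ> (\<lambda>\<omega>. restrict (coupling \<omega>) (E - S i)))
       borel ((\<lambda>h. p (local_field (S i) h \<sigma>)) \<circ> (\<lambda>\<omega>. restrict (coupling \<omega>) (S i)))"
    proof (intro indep_var_compose[OF indep_var_restrict[OF indep]])
      show "q \<sigma> \<in> borel_measurable (Pi\<^sub>M (E - S i) (\<lambda>_. borel))"
        unfolding q_def gibbs_weight_def by measurable
      show "(\<lambda>h. p (local_field (S i) h \<sigma>)) \<in> borel_measurable (Pi\<^sub>M (S i) (\<lambda>_. borel))"
        unfolding p_def local_field_def by measurable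
    qed (use S in auto)
    \<comment> \<open>Restricting the couplings does not alter the weight of the remaining edges, so
      the independence transfers to \<open>q\<close> itself.\<close>
    moreover have "gibbs_weight (E - S i) b (restrict (coupling \<omega>) (E - S i)) = gibbs_weight (E - S i) b (coupling \<omega>)" for \<omega>
      by (intro ext gibbs_weight_cong) auto
    ultimately show ?thesis
      by (simp add: comp_def q_def Y_def local_field_def)
  qed
  have qp_int: "integrable M (\<lambda>\<omega>. q \<sigma> (coupling \<omega>) * p (Y \<sigma> \<omega>))" if "\<sigma> \<in> ?\<Omega>" for \<sigma>
    by (rule indep_var_integrable[OF ind q_int[OF that] p_int[OF that]])
  have qp: "expectation (\<lambda>\<omega>. q \<sigma> (coupling \<omega>) * p (Y \<sigma> \<omega>)) =
      expectation (\<lambda>\<omega>. q \<sigma> (coupling \<omega>)) * (c * real (card (S i)) - c ^ 3 * (real (card (S i)))\<^sup>2)"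
    if "\<sigma> \<in> ?\<Omega>" for \<sigma>
    using indep_var_lebesgue_integral[OF ind q_int[OF that] p_int[OF that]] expectation_local_field[OF S that]
    by (simp add: p_def Y_def)
  \<comment> \<open>With k the degree, c^3 k^2 = (c k)(c^2 k), and the hypothesis
    \<open>small\<close> bounds the second factor by 1/4.\<close>
  have "3 / 4 * c * real (card (S i)) \<le> c * real (card (S i)) - c ^ 3 * (real (card (S i)))\<^sup>2"
  proof -
    have "c * real (card (S i)) * (4 * (c\<^sup>2 * real (card (S i)))) \<le> c * real (card (S i)) * 1"
      using c small by (intro mult_left_mono) auto
    then show ?thesis by (simp add: eval_nat_numeral algebra_simps)
  qed
  also have "\<dots> = expectation (\<lambda>\<omega>. \<Sum>\<sigma>\<in>?\<Omega>. q \<sigma> (coupling \<omega>)) * (c * real (card (S i)) - c ^ 3 * (real (card (S i)))\<^sup>2)"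
    by (simp add: q_sum prob_space)
  also have "\<dots> = expectation (\<lambda>\<omega>. \<Sum>\<sigma>\<in>?\<Omega>. q \<sigma> (coupling \<omega>) * p (Y \<sigma> \<omega>))"
    using qp qp_int q_int by (simp add: sum_distrib_right)
  also have "\<dots> \<le> expectation (\<lambda>\<omega>. \<Sum>e\<in>S i. g e \<omega> * edge_mean V E b e (coupling \<omega>))"
  proof (rule integral_mono)
    show "integrable M (\<lambda>\<omega>. \<Sum>\<sigma>\<in>?\<Omega>. q \<sigma> (coupling \<omega>) * p (Y \<sigma> \<omega>))"
      using qp_int by auto
    show "integrable M (\<lambda>\<omega>. \<Sum>e\<in>S i. g e \<omega> * edge_mean V E b e (coupling \<omega>))"
      using S by (intro Bochner_Integration.integrable_sum integrable_edge_mean) auto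
    fix \<omega>
    have "(\<Sum>\<sigma>\<in>?\<Omega>. q \<sigma> (coupling \<omega>) * p (Y \<sigma> \<omega>)) \<le> (\<Sum>\<sigma>\<in>?\<Omega>. q \<sigma> (coupling \<omega>) * (Y \<sigma> \<omega> * tanh (c * Y \<sigma> \<omega>)))"
      unfolding p_def using q_nonneg c by (intro sum_mono mult_left_mono times_tanh_ge)
    also have "\<dots> \<le> (\<Sum>e\<in>S i. g e \<omega> * edge_mean V E b e (coupling \<omega>))"
      using sum_star_edge_mean_ge[OF finite_V finite_E finite_edge i c, of "coupling \<omega>"]
      by (simp add: q_def Y_def S_def)
    finally show "(\<Sum>\<sigma>\<in>?\<Omega>. q \<sigma> (coupling \<omega>) * p (Y \<sigma> \<omega>)) \<le> (\<Sum>e\<in>S i. g e \<omega> * edge_mean V E b e (coupling \<omega>))" .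
  qed
  finally show ?thesis .
qed

section \<open>Covariance of the free energy with the test function\<close>

lemma covariance_free_energy_ge:
  assumes b: "0 < b" and c: "0 \<le> c" "c \<le> b" and small: "\<And>i. i \<in> V \<Longrightarrow> 4 * (c\<^sup>2 * real (degree E i)) \<le> 1"
  shows "3 / 4 * c * real (card E) \<le> expectation (\<lambda>\<omega>. free_energy V E (coupling \<omega>) (ereal b) * test_fun \<omega>)"
proof -
  define m where "m e = expectation (\<lambda>\<omega>. g e \<omega> * edge_mean V E b e (coupling \<omega>))" for e
  have int': "integrable M (\<lambda>\<omega>. ((g e \<omega>)\<^sup>2 - 1) * free_energy V E (coupling \<omega>) (ereal b))" if "e \<in> E" for e
    by (rule integrable_size_boundI[OF _ abs_mult_size_bound[OF abs_square_minus_1_le abs_free_energy_size_bound]])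
      (use that b in auto)
  have star: "3 / 4 * c * real (card {e \<in> E. i \<in> e}) \<le> (\<Sum>e | e \<in> E \<and> i \<in> e. m e)" if "i \<in> V" for i
    using expectation_star_ge[OF that c] small[OF that] integrable_edge_mean by (simp add: degree_def m_def)
  have "3 / 4 * c * real (\<Sum>i\<in>V. card {e \<in> E. i \<in> e}) \<le> (\<Sum>i\<in>V. \<Sum>e | e \<in> E \<and> i \<in> e. m e)"
    unfolding of_nat_sum sum_distrib_left by (intro sum_mono star)
  \<comment> \<open>Double counting gives a factor 2 on both sides, which cancels.\<close>
  then have "3 / 4 * c * real (card E) \<le> (\<Sum>e\<in>E. m e)"
    unfolding sum_degree[OF graph] by simp
  also have "\<dots> = (\<Sum>e\<in>E. expectation (\<lambda>\<omega>. ((g e \<omega>)\<^sup>2 - 1) * free_energy V E (coupling \<omega>) (ereal b)))"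
    unfolding m_def using b by (intro sum.cong refl Stein_free_energy[symmetric])
  also have "\<dots> = expectation (\<lambda>\<omega>. \<Sum>e\<in>E. ((g e \<omega>)\<^sup>2 - 1) * free_energy V E (coupling \<omega>) (ereal b))"
    by (rule Bochner_Integration.integral_sum[symmetric]) (rule int')
  also have "\<dots> = expectation (\<lambda>\<omega>. free_energy V E (coupling \<omega>) (ereal b) * test_fun \<omega>)"
    by (simp add: test_fun_def sum_distrib_left mult.commute)
  finally show ?thesis .
qed

lemma integrable_test_fun: "integrable M test_fun" "integrable M (\<lambda>\<omega>. (test_fun \<omega>)\<^sup>2)"
  unfolding power2_eq_square
  by (rule integrable_size_boundI[OF _ abs_test_fun_le]
      integrable_size_boundI[OF _ abs_mult_size_bound[OF abs_test_fun_le abs_test_fun_le]]; measurable)+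

text \<open>The free energies at \<open>b\<close> and at infinity differ by at most ln(card
  (spin_configs V)) / b uniformly in the couplings, so the covariances differ by at most K / b. With
  \<open>c\<close> fixed this error vanishes as \<open>b\<close> grows.\<close>

lemma covariance_ground_state_ge:
  assumes c: "0 \<le> c" and small: "\<And>i. i \<in> V \<Longrightarrow> 4 * (c\<^sup>2 * real (degree E i)) \<le> 1"
  shows "3 / 4 * c * real (card E) \<le> expectation (\<lambda>\<omega>. free_energy V E (coupling \<omega>) \<infinity> * test_fun \<omega>)"
proof -
  define K where "K = ln (real (card (spin_configs V))) * expectation (\<lambda>\<omega>. \<bar>test_fun \<omega>\<bar>)"
  have bound: "3 / 4 * c * real (card E) \<le> expectation (\<lambda>\<omega>. free_energy V E (coupling \<omega>) \<infinity> * test_fun \<omega>) + K / b"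
    if b: "0 < b" "c \<le> b" for b
  proof -
    have int: "integrable M (\<lambda>\<omega>. free_energy V E (coupling \<omega>) \<infinity> * test_fun \<omega>)"
      by (rule integrable_size_boundI[OF _ abs_mult_size_bound[OF abs_free_energy_infinity_size_bound abs_test_fun_le]])
        measurable
    have "3 / 4 * c * real (card E) \<le> expectation (\<lambda>\<omega>. free_energy V E (coupling \<omega>) (ereal b) * test_fun \<omega>)"
      using b c small by (intro covariance_free_energy_ge)
    also have "\<dots> \<le> expectation (\<lambda>\<omega>. free_energy V E (coupling \<omega>) \<infinity> * test_fun \<omega> +
        ln (real (card (spin_configs V))) / b * \<bar>test_fun \<omega>\<bar>)"
    proof (rule integral_mono)
      show "integrable M (\<lambda>\<omega>. free_energy V E (coupling \<omega>) (ereal b) * test_fun \<omega>)"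
        by (rule integrable_size_boundI[OF _ abs_mult_size_bound[OF abs_free_energy_size_bound[OF b(1)] abs_test_fun_le]])
          measurable
      show "integrable M (\<lambda>\<omega>. free_energy V E (coupling \<omega>) \<infinity> * test_fun \<omega> +
        ln (real (card (spin_configs V))) / b * \<bar>test_fun \<omega>\<bar>)"
        using int integrable_test_fun(1) by auto
      fix \<omega>
      \<comment> \<open>The free energy at \<open>b\<close> dominates the one at infinity, so
        replacing the test function by its absolute value can only increase the product.\<close>
      have "(free_energy V E (coupling \<omega>) (ereal b) - free_energy V E (coupling \<omega>) \<infinity>) * test_fun \<omega>
          \<le> (free_energy V E (coupling \<omega>) (ereal b) - free_energy V E (coupling \<omega>) \<infinity>) * \<bar>test_fun \<omega>\<bar>"
        using free_energy_infinity_le(1)[OF finite_V b(1), of E "coupling \<omega>"] by (intro mult_left_mono) auto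
      also have "\<dots> \<le> ln (real (card (spin_configs V))) / b * \<bar>test_fun \<omega>\<bar>"
        using free_energy_infinity_le(2)[OF finite_V b(1), of E "coupling \<omega>"] by (intro mult_right_mono) auto
      finally show "free_energy V E (coupling \<omega>) (ereal b) * test_fun \<omega> \<le> free_energy V E (coupling \<omega>) \<infinity> * test_fun \<omega> +
        ln (real (card (spin_configs V))) / b * \<bar>test_fun \<omega>\<bar>"
        by (simp add: algebra_simps)
    qed
    also have "\<dots> = expectation (\<lambda>\<omega>. free_energy V E (coupling \<omega>) \<infinity> * test_fun \<omega>) + K / b"
      using int integrable_test_fun(1) by (simp add: K_def)
    finally show ?thesis .
  qed
  have "\<forall>\<^sub>F b in at_top. 3 / 4 * c * real (card E) \<le> expectation (\<lambda>\<omega>. free_energy V E (coupling \<omega>) \<infinity> * test_fun \<omega>) + K / b"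
    using eventually_gt_at_top[of 0] eventually_ge_at_top[of c]
    by eventually_elim (rule bound)
  moreover have "((\<lambda>b. expectation (\<lambda>\<omega>. free_energy V E (coupling \<omega>) \<infinity> * test_fun \<omega>) + K / b) \<longlongrightarrow>
      expectation (\<lambda>\<omega>. free_energy V E (coupling \<omega>) \<infinity> * test_fun \<omega>) + 0) at_top"
    by (intro tendsto_add tendsto_const real_tendsto_divide_at_top[OF tendsto_const filterlim_ident])
  ultimately show ?thesis
    by (intro tendsto_lowerbound[where F = at_top]) auto
qed

section \<open>From covariance to variance\<close>

lemma variance_ge_of_covariance:
  assumes [measurable]: "F \<in> borel_measurable M" and F: "\<And>\<omega>. \<bar>F \<omega>\<bar> \<le> C * size_bound \<omega> ^ 1"
    and cov: "3 / 4 * c * real (card E) \<le> expectation (\<lambda>\<omega>. F \<omega> * test_fun \<omega>)" and c: "0 \<le> c"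
  shows "9 * real (card E) / 32 * c\<^sup>2 \<le> variance F"
proof -
  \<comment> \<open>The multiplier s = 3/8 c is the covariance bound 3/4 c card E divided by the
    second moment 2 card E, which maximises the quadratic in \<open>s\<close>.\<close>
  have "9 * real (card E) / 32 * c\<^sup>2 = 2 * (3 / 8 * c) * (3 / 4 * c * real (card E)) - (3 / 8 * c)\<^sup>2 * (2 * real (card E))"
    by (simp add: power2_eq_square field_simps)
  also have "\<dots> \<le> 2 * (3 / 8 * c) * expectation (\<lambda>\<omega>. F \<omega> * test_fun \<omega>) -
      (3 / 8 * c)\<^sup>2 * expectation (\<lambda>\<omega>. (test_fun \<omega>)\<^sup>2)"
    unfolding expectation_test_fun_square using cov c by (intro diff_right_mono mult_left_mono) auto
  also have "\<dots> \<le> variance F"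
  proof (rule variance_ge_test_function)
    show "integrable M F"
      by (rule integrable_size_boundI[OF _ F]) measurable
    show "integrable M (\<lambda>x. (F x)\<^sup>2)"
      unfolding power2_eq_square by (rule integrable_size_boundI[OF _ abs_mult_size_bound[OF F F]]) measurable
    show "integrable M (\<lambda>x. F x * test_fun x)"
      by (rule integrable_size_boundI[OF _ abs_mult_size_bound[OF F abs_test_fun_le]]) measurable
  qed (rule integrable_test_fun expectation_test_fun)+
  finally show ?thesis .
qed

end

theorem theorem1p8:
  fixes V :: "'v set" and E :: "'v set set"
    and M :: "'w measure" and g :: "'v set \<Rightarrow> 'w \<Rightarrow> real"
    and \<beta> :: ereal and d :: nat
  assumes "simple_graph V E" and "E \<noteq> {}" and "d = max_degree V E"
    and "prob_space M" and "iid_std_gaussian M E g"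
    and "0 < \<beta>"
  shows "ereal (prob_space.variance M (\<lambda>\<omega>. free_energy V E (\<lambda>e. g e \<omega>) \<beta>))
           \<ge> ereal (9 * real (card E) / 32) * min (\<beta>\<^sup>2) (ereal (1 / (4 * (real d)\<^sup>2)))"
proof -
  interpret spin_glass M V E g
    using assms by (simp add: spin_glass_def spin_glass_axioms_def)
  have degree_le: "degree E i \<le> d" if "i \<in> V" for i
    unfolding assms(3) max_degree_def using that finite_V by (intro Max_ge) auto
  \<comment> \<open>An edge has an endpoint, whose degree is positive; hence \<open>d\<close> is at
    least 1 and the divisions by it are genuine.\<close>
  obtain e where e: "e \<in> E" using assms(2) by auto
  then obtain i where "i \<in> e" using edge_card[OF e] by fastforce
  then have "i \<in> V" "0 < degree E i"
    using e edge_subset[OF e] finite_E by (auto simp: degree_def card_gt_0_iff)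
  then have d: "1 \<le> d" using degree_le[of i] by simp
  \<comment> \<open>This threshold makes c^2 times any degree at most c0^2 d = 1 / (4 d), hence at
    most 1/4.\<close>
  define c0 where "c0 = 1 / (2 * real d)"
  have c0: "0 < c0" "c0\<^sup>2 = 1 / (4 * (real d)\<^sup>2)"
    using d by (simp_all add: c0_def power_divide power_mult_distrib)
  have small: "4 * (c\<^sup>2 * real (degree E i)) \<le> 1" if "0 \<le> c" "c \<le> c0" "i \<in> V" for c i
  proof -
    have "c\<^sup>2 * real (degree E i) \<le> c0\<^sup>2 * real d"
      using that degree_le by (intro mult_mono power_mono) auto
    also have "\<dots> \<le> 1 / 4"
      unfolding c0(2) using d by (simp add: power2_eq_square field_simps)
    finally show ?thesis by simp
  qed
  show ?thesis
  proof (cases \<beta>)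
    case (real b)
    then have b: "0 < b" using assms(6) by simp
    define c where "c = min b c0"
    have c: "0 \<le> c" "c \<le> b" "c \<le> c0" using b c0 by (auto simp: c_def)
    \<comment> \<open>Both candidates are positive, so squaring commutes with the minimum.\<close>
    have c2: "min (\<beta>\<^sup>2) (ereal (1 / (4 * (real d)\<^sup>2))) = ereal (c\<^sup>2)"
      unfolding c0(2)[symmetric] real c_def using b c0(1) by (auto simp: min_def power_mono_iff)
    show ?thesis
      unfolding c2 unfolding real
      using variance_ge_of_covariance[OF measurable_free_energy abs_free_energy_size_bound[OF b]
          covariance_free_energy_ge[OF b c(1,2) small[OF c(1,3)]] c(1)] by simp
  next
    case PInf
    \<comment> \<open>At infinite \<beta> the minimum is the degree term, so c = c0.\<close>
    have c2: "min (\<beta>\<^sup>2) (ereal (1 / (4 * (real d)\<^sup>2))) = ereal (c0\<^sup>2)"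
      unfolding c0(2) PInf by simp
    show ?thesis
      unfolding c2 unfolding PInf
      using variance_ge_of_covariance[OF measurable_free_energy_infinity abs_free_energy_infinity_size_bound
          covariance_ground_state_ge[OF less_imp_le[OF c0(1)] small] less_imp_le[OF c0(1)]] c0 by simp
  qed (use assms(6) in simp)
qed

end
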